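(* Consider the standard linear bifactor model and let $(A,\mathbf d,\boldsymbol\lambda)\in\mathfrak P$. The model is identifiable at $(A,\mathbf d,\boldsymbol\lambda)$ if and only if at least one of the following two conditions holds: (P1) $|\mathcal Q_g|\ge 3$ for all $g=1,\dots,G$, and $|\mathcal H_1|\ge 3$; (P2) $|\mathcal Q_g|\ge 3$ for all $g=1,\dots,G$, $|\mathcal H_1|=2$, and $|\mathcal H_2|\ge 1$.
   Context: Standard linear bifactor model. Fix $G\ge 1$ and items $\{1,\dots,J\}$ with a fixed known partition into $G$ nonempty testlets $\mathcal B_1,\dots,\mathcal B_G$; $g_j$ is the testlet containing item $j$. Parameters: a real $J\times(1+G)$ loading matrix $A=[\mathbf a_0,\mathbf a_1,\dots,\mathbf a_G]$ with $\mathbf a_g[j]=0$ whenever $g\ge1$ and $g\ne g_j$ (the other entries are arbitrary reals, possibly zero); intercepts $\mathbf d\in\mathbb R^J$; unique variances $\boldsymbol\lambda=(\lambda_1,\dots,\lambda_J)$ with $\lambda_j>0$. The observed vector $(Y_1,\dots,Y_J)$ is $$Y_j=d_j+\mathbf a_0[j]\,\eta_0+\mathbf a_{g_j}[j]\,\eta_{g_j}+\epsilon_j,$$ where $\boldsymbol\eta=(\eta_0,\eta_1,\dots,\eta_G)^T\sim N(\mathbf 0,I_{1+G})$, and the $\epsilon_j\sim N(0,\lambda_j)$ are independent of each other and of $\boldsymbol\eta$. The parameter space $\mathfrak P$ is the set of all such $(A,\mathbf d,\boldsymbol\lambda)$ for which the first nonzero entry of every column of $A$ is positive (no requirement on a zero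 column). The model is identifiable at $(A,\mathbf d,\boldsymbol\lambda)\in\mathfrak P$ if every $(A',\mathbf d',\boldsymbol\lambda')\in\mathfrak P$ that defines the same distribution of $(Y_1,\dots,Y_J)$ equals $(A,\mathbf d,\boldsymbol\lambda)$. Notation: $x[\mathcal B]$ is the subvector of $x$ with entries in $\mathcal B$; $M[\mathcal B,:]$ is the submatrix of rows indexed by $\mathcal B$; $\bar A_g=(\mathbf a_0[\mathcal B_g],\mathbf a_g[\mathcal B_g])$ is the $|\mathcal B_g|\times 2$ matrix of main and testlet loadings of testlet $g$ (rows indexed by $\mathcal B_g$). - $\mathcal Q_g=\{j:\mathbf a_g[j]\ne 0\}$ for $g=1,\dots,G$. - $\mathcal H_1=\{g\in\{1,\dots,G\}:\mathbf a_0[\mathcal B_g]\ne\mathbf 0\}$. - $\mathcal H_2$ is the set of $g\in\{1,\dots,G\}$ for which there is a partition $\mathcal B_g=\mathcal B_{g,1}\cup\mathcal B_{g,2}$, $\mathcal B_{g,1}\cap\mathcal B_{g,2}=\emptyset$, such that both $\bar A_g[\mathcal B_{g,1},:]$ and $\bar A_g[\mathcal B_{g,2},:]$ have full column rank (rank 2). *)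

theory Defs
  imports
    "HOL-Probability.Probability"
    "Jordan_Normal_Form.DL_Rank"
    "Jordan_Normal_Form.DL_Submatrix"
begin

(* Leave the infix $ and the type name vec to the matrices of Jordan_Normal_Form. *)
unbundle no vec_syntax
hide_type (open) Finite_Cartesian_Product.vec
hide_const (open) Finite_Cartesian_Product.vec Finite_Cartesian_Product.row
  Finite_Cartesian_Product.column

(* Items are {..<J}, since matrix rows are indexed from 0. Column 0 of the loading matrix is the
   main factor, columns 1..G are the testlet factors. A partition of the items into G nonempty
   testlets is given by a map t with t ` {..<J} = {1..G}; t j is the testlet of item j. *)

definition testlet_items :: "nat \<Rightarrow> (nat \<Rightarrow> nat) \<Rightarrow> nat \<Rightarrow> nat set" where
  "testlet_items J t g = {j. j < J \<and> t j = g}"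

(* (A, d, l): loadings, intercepts, unique variances *)
type_synonym bifactor_params = "real mat \<times> real vec \<times> real vec"

definition bifactor_param_space :: "nat \<Rightarrow> nat \<Rightarrow> (nat \<Rightarrow> nat) \<Rightarrow> bifactor_params set" where
  "bifactor_param_space J G t = {(A, d, l).
     A \<in> carrier_mat J (1 + G) \<and> d \<in> carrier_vec J \<and> l \<in> carrier_vec J \<and>
     (\<forall>j<J. \<forall>g\<in>{1..G}. g \<noteq> t j \<longrightarrow> A $$ (j, g) = 0) \<and>
     (\<forall>j<J. l $ j > 0) \<and>
     (\<forall>c\<le>G. \<forall>j<J. A $$ (j, c) \<noteq> 0 \<and> (\<forall>i<j. A $$ (i, c) = 0) \<longrightarrow> A $$ (j, c) > 0)}"

(* Joint law of the independent factors eta_0, ..., eta_G ~ N(0, 1) and errors eps_j ~ N(0, l_j).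
   The second argument of normal_density is a standard deviation, hence the square root. *)
definition bifactor_latent_law ::
    "nat \<Rightarrow> nat \<Rightarrow> real vec \<Rightarrow> ((nat \<Rightarrow> real) \<times> (nat \<Rightarrow> real)) measure" where
  "bifactor_latent_law J G l =
     (\<Pi>\<^sub>M k\<in>{0..G}. density lborel (normal_density 0 1)) \<Otimes>\<^sub>M
     (\<Pi>\<^sub>M j\<in>{..<J}. density lborel (normal_density 0 (sqrt (l $ j))))"

definition bifactor_response ::
    "nat \<Rightarrow> (nat \<Rightarrow> nat) \<Rightarrow> real mat \<Rightarrow> real vec \<Rightarrow> (nat \<Rightarrow> real) \<times> (nat \<Rightarrow> real) \<Rightarrow> nat \<Rightarrow> real" where
  "bifactor_response J t A d = (\<lambda>(\<eta>, \<epsilon>). \<lambda>j\<in>{..<J}.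
     d $ j + A $$ (j, 0) * \<eta> 0 + A $$ (j, t j) * \<eta> (t j) + \<epsilon> j)"

definition bifactor_law :: "nat \<Rightarrow> nat \<Rightarrow> (nat \<Rightarrow> nat) \<Rightarrow> bifactor_params \<Rightarrow> (nat \<Rightarrow> real) measure" where
  "bifactor_law J G t = (\<lambda>(A, d, l).
     distr (bifactor_latent_law J G l) (\<Pi>\<^sub>M j\<in>{..<J}. borel) (bifactor_response J t A d))"

(* distr is only meaningful for measurable maps. *)
lemma measurable_bifactor_response:
  assumes "t ` {..<J} = {1..G}"
  shows "bifactor_response J t A d \<in> bifactor_latent_law J G l \<rightarrow>\<^sub>M (\<Pi>\<^sub>M j\<in>{..<J}. borel)"
proof -
  have [measurable_cong]: "sets (bifactor_latent_law J G l) =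
      sets ((\<Pi>\<^sub>M k\<in>{0..G}. borel) \<Otimes>\<^sub>M (\<Pi>\<^sub>M j\<in>{..<J}. borel))"
    unfolding bifactor_latent_law_def by (intro sets_pair_measure_cong sets_PiM_cong) simp_all
  have *: "j < J \<Longrightarrow> t j \<in> {0..G}" for j
    using assms by fastforce
  show ?thesis
    unfolding bifactor_response_def case_prod_beta
    by (rule measurable_restrict) (use * in \<open>auto intro!: borel_measurable_add borel_measurable_times
      measurable_compose[OF measurable_fst measurable_component_singleton]
      measurable_compose[OF measurable_snd measurable_component_singleton] cong: measurable_cong_sets\<close>)
qed

definition bifactor_identifiable_at :: "nat \<Rightarrow> nat \<Rightarrow> (nat \<Rightarrow> nat) \<Rightarrow> bifactor_params \<Rightarrow> bool" where
  "bifactor_identifiable_at J G t \<theta> \<longleftrightarrow>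
     (\<forall>\<theta>'\<in>bifactor_param_space J G t. bifactor_law J G t \<theta>' = bifactor_law J G t \<theta> \<longrightarrow> \<theta>' = \<theta>)"

definition testlet_support :: "nat \<Rightarrow> real mat \<Rightarrow> nat \<Rightarrow> nat set" where
  "testlet_support J A g = {j. j < J \<and> A $$ (j, g) \<noteq> 0}"

definition main_loaded_testlets :: "nat \<Rightarrow> nat \<Rightarrow> (nat \<Rightarrow> nat) \<Rightarrow> real mat \<Rightarrow> nat set" where
  "main_loaded_testlets J G t A = {g\<in>{1..G}. \<exists>j\<in>testlet_items J t g. A $$ (j, 0) \<noteq> 0}"

(* submatrix A S {0, g} is the matrix of main and testlet loadings of testlet g restricted to
   the rows in S; the first argument of vec_space.rank is the number of rows. *)
definition split_rank_testlets :: "nat \<Rightarrow> nat \<Rightarrow> (nat \<Rightarrow> nat) \<Rightarrow> real mat \<Rightarrow> nat set" where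
  "split_rank_testlets J G t A = {g\<in>{1..G}. \<exists>B1 B2.
     B1 \<union> B2 = testlet_items J t g \<and> B1 \<inter> B2 = {} \<and>
     vec_space.rank (card B1) (submatrix A B1 {0, g}) = 2 \<and>
     vec_space.rank (card B2) (submatrix A B2 {0, g}) = 2}"

end

theory Submission
  imports Defs
begin

text \<open>
  Write \<open>a\<close> for the main loadings, \<open>b\<close> for the testlet loadings (the entry of
  item \<open>j\<close> in its own testlet column) and \<open>l\<close> for the unique variances. The
  observed vector is Gaussian, so its law amounts to the intercepts together with the covariances
  \<open>a i * a j\<close> for items of different testlets, \<open>a i * a j + b i * b j\<close> for
  different items of one testlet, and \<open>(a j)\<^sup>2 + (b j)\<^sup>2 + l j\<close> for an item
  with itself (\<open>bifactor_law_eq_iff\<close>). That the law determines these numbers is read off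
  from the characteristic function. Conversely, since every unique variance is positive, the law has a
  density that is an average of products of one-dimensional normal densities; writing each of these as a
  Fourier integral turns the density into an explicit function of intercepts and covariances, so equal
  covariances give equal laws. What remains is algebra.

  Sufficiency. The products of a vector over pairs of indices determine it up to sign as soon as three
  nonzero entries are available, because \<open>(x i)\<^sup>2 = (x i * x j) * (x i * x k) / (x j * x
  k)\<close>. If three testlets carry main loadings, the covariances across testlets are such products,
  so \<open>a\<close> is determined up to sign, and the sign convention fixes it. If only the testlets
  \<open>g\<close> and \<open>h\<close> carry main loadings, these covariances leave one free factor:
  \<open>a\<close> may be multiplied by \<open>c\<close> on \<open>g\<close> and by \<open>1 / c\<close>
  on \<open>h\<close>. Then the competing testlet loadings \<open>b'\<close> satisfy \<open>b' i * b' j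
  = (1 - c\<^sup>2) * (a i * a j) + b i * b j\<close>, and the minor with rows \<open>p, q\<close> and
  columns \<open>r, u\<close> vanishes on the left and is \<open>1 - c\<^sup>2\<close> times two 2-by-2
  determinants on the right. A split into two blocks of rank 2 provides nonzero determinants on disjoint
  pairs of items, which forces \<open>c\<^sup>2 = 1\<close>. With \<open>a\<close> known, the products
  \<open>b i * b j\<close> inside a testlet are known, three nonzero entries determine \<open>b\<close>,
  and the diagonal determines \<open>l\<close>.

  Necessity. A second parameter is obtained from any loadings with the same off-diagonal covariances
  that leave room for positive unique variances; the sign convention can be restored by flipping columns
  (\<open>not_identifiableI\<close>). A testlet with at most two nonzero testlet loadings permits
  enlarging one of them, or scaling the two by inverse factors. If no testlet carries main loadings, a
  small one can be introduced; if one does, its two columns of loadings can be rotated. If two do and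
  neither splits, then in each of them either all items but at most one have proportional loadings, or
  exactly three items have nonzero loadings (\<open>no_disjoint_independent_pairs_cases\<close>). In
  both cases the change of \<open>a\<close> by a factor close to 1 can be absorbed by a small change of
  \<open>b\<close>, so \<open>c\<close> on one testlet and \<open>1 / c\<close> on the other yield a
  different parameter with the same law.
\<close>

section \<open>Characteristic function and Fourier inversion for the normal distribution\<close>

lemma normal_characteristic_function:
  fixes s \<sigma> :: real
  assumes "0 < \<sigma>"
  shows "(LINT x|density lborel (normal_density 0 \<sigma>). iexp (s * x)) = complex_of_real (exp (- (\<sigma> * s)\<^sup>2 / 2))"
proof -
  have "(LINT x|density lborel (normal_density 0 \<sigma>). iexp (s * x))
      = (LINT x|lborel. normal_density 0 \<sigma> x *\<^sub>R iexp (s * x))"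
    by (subst integral_density) auto
  also have "\<dots> = \<bar>\<sigma>\<bar> *\<^sub>R (LINT x|lborel. normal_density 0 \<sigma> (0 + \<sigma> * x) *\<^sub>R iexp (s * (0 + \<sigma> * x)))"
    using assms by (intro lborel_integral_real_affine) auto
  also have "\<dots> = (LINT x|lborel. \<sigma> *\<^sub>R (normal_density 0 \<sigma> (\<sigma> * x) *\<^sub>R iexp (s * (\<sigma> * x))))"
    using assms by (simp only: integral_scaleR_right abs_of_pos add_0)
  also have "\<dots> = (LINT x|lborel. std_normal_density x *\<^sub>R iexp ((\<sigma> * s) * x))"
  proof (intro Bochner_Integration.integral_cong refl)
    fix x
    have "\<sigma> * normal_density 0 \<sigma> (\<sigma> * x) = std_normal_density x"
      using assms by (simp add: normal_density_def real_sqrt_mult power_mult_distrib)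
    then show "\<sigma> *\<^sub>R (normal_density 0 \<sigma> (\<sigma> * x) *\<^sub>R iexp (s * (\<sigma> * x)))
       = std_normal_density x *\<^sub>R iexp ((\<sigma> * s) * x)"
      by (simp add: mult_ac)
  qed
  also have "\<dots> = char std_normal_distribution (\<sigma> * s)"
    unfolding char_def by (subst integral_density) auto
  finally show ?thesis
    by (simp add: char_std_normal_distribution)
qed

text \<open>
  Up to a factor, the normal density is itself the characteristic function of a normal law with the
  reciprocal standard deviation. Thus this inversion formula is just
  \<open>normal_characteristic_function\<close> with the roles of frequency and space exchanged.
\<close>

lemma normal_density_Fourier:
  fixes u \<sigma> :: real
  assumes "0 < \<sigma>"
  shows "integrable lborel (\<lambda>s. complex_of_real (exp (- (\<sigma> * s)\<^sup>2 / 2) / (2 * pi)) * iexp (s * u))"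
    and "(LINT s|lborel. complex_of_real (exp (- (\<sigma> * s)\<^sup>2 / 2) / (2 * pi)) * iexp (s * u))
      = complex_of_real (normal_density 0 \<sigma> u)"
proof -
  let ?c = "1 / (sqrt (2 * pi) * \<sigma>)"
  have k: "exp (- (\<sigma> * s)\<^sup>2 / 2) / (2 * pi) = ?c * normal_density 0 (1 / \<sigma>) s" for s
    using assms
    by (simp add: normal_density_def real_sqrt_mult real_sqrt_divide power_mult_distrib power_divide field_simps)
  have eq: "complex_of_real (exp (- (\<sigma> * s)\<^sup>2 / 2) / (2 * pi)) * iexp (s * u)
      = ?c *\<^sub>R (normal_density 0 (1 / \<sigma>) s *\<^sub>R iexp (u * s))" for s
    unfolding k by (simp add: scaleR_conv_of_real mult_ac)
  have int: "integrable lborel (\<lambda>s. normal_density 0 (1 / \<sigma>) s *\<^sub>R iexp (u * s))"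
    by (rule Bochner_Integration.integrable_bound[where f = "normal_density 0 (1/\<sigma>)"]) (use assms in auto)
  then show "integrable lborel (\<lambda>s. complex_of_real (exp (- (\<sigma> * s)\<^sup>2 / 2) / (2 * pi)) * iexp (s * u))"
    unfolding eq by (intro integrable_scaleR_right) auto
  have "(LINT s|lborel. complex_of_real (exp (- (\<sigma> * s)\<^sup>2 / 2) / (2 * pi)) * iexp (s * u))
      = ?c *\<^sub>R (LINT s|lborel. normal_density 0 (1 / \<sigma>) s *\<^sub>R iexp (u * s))"
    unfolding eq by (rule integral_scaleR_right)
  also have "(LINT s|lborel. normal_density 0 (1 / \<sigma>) s *\<^sub>R iexp (u * s))
      = (LINT s|density lborel (normal_density 0 (1 / \<sigma>)). iexp (u * s))"
    by (subst integral_density) auto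
  also have "\<dots> = complex_of_real (exp (- (1 / \<sigma> * u)\<^sup>2 / 2))"
    using assms by (subst normal_characteristic_function) auto
  also have "?c *\<^sub>R \<dots> = complex_of_real (normal_density 0 \<sigma> u)"
    using assms by (simp add: normal_density_def real_sqrt_mult power_divide scaleR_conv_of_real)
  finally show "(LINT s|lborel. complex_of_real (exp (- (\<sigma> * s)\<^sup>2 / 2) / (2 * pi)) * iexp (s * u))
      = complex_of_real (normal_density 0 \<sigma> u)" .
qed

abbreviation normal_prod :: "'i set \<Rightarrow> ('i \<Rightarrow> real) \<Rightarrow> ('i \<Rightarrow> real) measure" where
  "normal_prod I \<sigma> \<equiv> (\<Pi>\<^sub>M i\<in>I. density lborel (normal_density 0 (\<sigma> i)))"

lemma prob_space_normal_prod: "(\<And>i. 0 < \<sigma> i) \<Longrightarrow> prob_space (normal_prod I \<sigma>)"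
  by (intro prob_space_PiM prob_space_normal_density) auto

lemma product_sigma_finite_normal:
  "(\<And>i. 0 < \<sigma> i) \<Longrightarrow> product_sigma_finite (\<lambda>i. density lborel (normal_density 0 (\<sigma> i)))"
  by (simp add: product_sigma_finite_def prob_space_normal_density prob_space_imp_sigma_finite)

lemma sets_normal_prod [measurable_cong]: "sets (normal_prod I \<sigma>) = sets (\<Pi>\<^sub>M i\<in>I. borel)"
  by (intro sets_PiM_cong) auto

lemma normal_prod_characteristic_function:
  fixes c \<sigma> :: "'i \<Rightarrow> real"
  assumes "finite I" "\<And>i. 0 < \<sigma> i"
  shows "(LINT x|normal_prod I \<sigma>. iexp (\<Sum>i\<in>I. c i * x i))
    = complex_of_real (exp (- (\<Sum>i\<in>I. (\<sigma> i * c i)\<^sup>2) / 2))"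
proof -
  interpret product_sigma_finite "\<lambda>i. density lborel (normal_density 0 (\<sigma> i))"
    by (rule product_sigma_finite_normal) fact
  have "(LINT x|normal_prod I \<sigma>. iexp (\<Sum>i\<in>I. c i * x i))
      = (LINT x|normal_prod I \<sigma>. (\<Prod>i\<in>I. iexp (c i * x i)))"
    using assms(1) by (simp add: sum_distrib_left exp_sum)
  also have "\<dots> = (\<Prod>i\<in>I. LINT x|density lborel (normal_density 0 (\<sigma> i)). iexp (c i * x))"
  proof (rule product_integral_prod[OF assms(1)])
    fix i
    interpret N: prob_space "density lborel (normal_density 0 (\<sigma> i))"
      by (rule prob_space_normal_density) (rule assms)
    show "integrable (density lborel (normal_density 0 (\<sigma> i))) (\<lambda>x. iexp (c i * x))"
      by (rule N.integrable_const_bound[where B = 1]) auto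
  qed
  also have "\<dots> = (\<Prod>i\<in>I. complex_of_real (exp (- (\<sigma> i * c i)\<^sup>2 / 2)))"
    using assms(2) by (simp only: normal_characteristic_function)
  also have "\<dots> = complex_of_real (\<Prod>i\<in>I. exp (- (\<sigma> i * c i)\<^sup>2 / 2))"
    by simp
  also have "(\<Prod>i\<in>I. exp (- (\<sigma> i * c i)\<^sup>2 / 2)) = exp (\<Sum>i\<in>I. - (\<sigma> i * c i)\<^sup>2 / 2)"
    using assms(1) by (simp add: exp_sum)
  also have "(\<Sum>i\<in>I. - (\<sigma> i * c i)\<^sup>2 / 2) = - (\<Sum>i\<in>I. (\<sigma> i * c i)\<^sup>2) / 2"
    by (simp add: sum_negf sum_divide_distrib)
  finally show ?thesis .
qed

lemma std_normal_prod_characteristic_function: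
  fixes c :: "'i \<Rightarrow> real"
  assumes "finite I"
  shows "(LINT x|normal_prod I (\<lambda>_. 1). iexp (\<Sum>i\<in>I. c i * x i))
    = complex_of_real (exp (- (\<Sum>i\<in>I. (c i)\<^sup>2) / 2))"
  using normal_prod_characteristic_function[of I "\<lambda>_. 1" c] assms by simp

section \<open>Linear factor models: the law determines mean and covariance\<close>

text \<open>
  The linear factor model with arbitrary loadings \<open>L\<close>, means \<open>d\<close> and error standard deviations \<open>\<sigma>\<close>. The
  bifactor model is the case in which every item loads on the main factor and on its testlet factor.
\<close>

definition factor_law :: "'i set \<Rightarrow> 'k set \<Rightarrow> ('i \<Rightarrow> real) \<Rightarrow> ('i \<Rightarrow> 'k \<Rightarrow> real) \<Rightarrow> ('i \<Rightarrow> real) \<Rightarrow> ('i \<Rightarrow> real) measure" where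
  "factor_law I K d L \<sigma> =
     distr (normal_prod K (\<lambda>_. 1) \<Otimes>\<^sub>M normal_prod I \<sigma>) (\<Pi>\<^sub>M i\<in>I. borel)
       (\<lambda>(\<eta>, \<epsilon>). \<lambda>i\<in>I. d i + (\<Sum>k\<in>K. L i k * \<eta> k) + \<epsilon> i)"

definition factor_cov :: "'k set \<Rightarrow> ('i \<Rightarrow> 'k \<Rightarrow> real) \<Rightarrow> ('i \<Rightarrow> real) \<Rightarrow> 'i \<Rightarrow> 'i \<Rightarrow> real" where
  "factor_cov K L \<sigma> i j = (\<Sum>k\<in>K. L i k * L j k) + (if i = j then (\<sigma> i)\<^sup>2 else 0)"

text \<open>
  The left-hand side is what the characteristic functions of independent factors and errors
  produce; the right-hand side shows that it depends on loadings and standard deviations through the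
  covariances only.
\<close>

lemma factor_cov_quadratic_form:
  assumes "finite I"
  shows "(\<Sum>k\<in>K. (\<Sum>i\<in>I. s i * L i k)\<^sup>2) + (\<Sum>i\<in>I. (\<sigma> i * s i)\<^sup>2)
    = (\<Sum>i\<in>I. \<Sum>j\<in>I. s i * s j * factor_cov K L \<sigma> i j)"
proof -
  have "(\<Sum>k\<in>K. (\<Sum>i\<in>I. s i * L i k)\<^sup>2) = (\<Sum>k\<in>K. \<Sum>i\<in>I. \<Sum>j\<in>I. s i * s j * (L i k * L j k))"
    by (simp add: power2_eq_square sum_product mult_ac)
  also have "\<dots> = (\<Sum>i\<in>I. \<Sum>k\<in>K. \<Sum>j\<in>I. s i * s j * (L i k * L j k))"
    by (rule sum.swap)
  also have "\<dots> = (\<Sum>i\<in>I. \<Sum>j\<in>I. s i * s j * (\<Sum>k\<in>K. L i k * L j k))"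
    unfolding sum_distrib_left by (intro sum.cong refl sum.swap)
  finally have 1: "(\<Sum>k\<in>K. (\<Sum>i\<in>I. s i * L i k)\<^sup>2) = \<dots>" .
  have 2: "(\<Sum>i\<in>I. (\<sigma> i * s i)\<^sup>2) = (\<Sum>i\<in>I. \<Sum>j\<in>I. s i * s j * (if i = j then (\<sigma> i)\<^sup>2 else 0))"
    using assms by (intro sum.cong) (simp_all add: if_distrib power2_eq_square mult_ac cong: if_cong)
  show ?thesis
    unfolding 1 2 factor_cov_def distrib_left sum.distrib ..
qed

lemma factor_response_measurable [measurable]:
  fixes d :: "'i \<Rightarrow> real" and L :: "'i \<Rightarrow> 'k \<Rightarrow> real"
  shows "(\<lambda>(\<eta>, \<epsilon>). \<lambda>i\<in>I. d i + (\<Sum>k\<in>K. L i k * \<eta> k) + \<epsilon> i)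
    \<in> normal_prod K (\<lambda>_. 1) \<Otimes>\<^sub>M normal_prod I \<sigma> \<rightarrow>\<^sub>M (\<Pi>\<^sub>M i\<in>I. borel)"
  by measurable

lemma factor_law_characteristic_function:
  fixes d \<sigma> s :: "'i \<Rightarrow> real" and L :: "'i \<Rightarrow> 'k \<Rightarrow> real"
  assumes "finite I" "finite K" "\<And>i. 0 < \<sigma> i"
  shows "(LINT y|factor_law I K d L \<sigma>. iexp (\<Sum>i\<in>I. s i * y i))
    = iexp (\<Sum>i\<in>I. s i * d i)
      * complex_of_real (exp (- (\<Sum>i\<in>I. \<Sum>j\<in>I. s i * s j * factor_cov K L \<sigma> i j) / 2))"
proof -
  interpret E: prob_space "normal_prod K (\<lambda>_. 1)" by (rule prob_space_normal_prod) simp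
  interpret U: prob_space "normal_prod I \<sigma>" by (rule prob_space_normal_prod) fact
  interpret P: pair_prob_space "normal_prod K (\<lambda>_. 1)" "normal_prod I \<sigma>" ..
  let ?c = "\<lambda>k. \<Sum>i\<in>I. s i * L i k"
  have lin: "(\<Sum>i\<in>I. s i * (d i + (\<Sum>k\<in>K. L i k * \<eta> k) + \<epsilon> i))
      = (\<Sum>i\<in>I. s i * d i) + (\<Sum>k\<in>K. ?c k * \<eta> k) + (\<Sum>i\<in>I. s i * \<epsilon> i)" for \<eta> \<epsilon>
  proof -
    have "(\<Sum>i\<in>I. s i * (\<Sum>k\<in>K. L i k * \<eta> k)) = (\<Sum>k\<in>K. ?c k * \<eta> k)"
      unfolding sum_distrib_left sum_distrib_right by (subst sum.swap) (simp add: mult_ac)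
    then show ?thesis by (simp add: distrib_left sum.distrib)
  qed
  have "(LINT y|factor_law I K d L \<sigma>. iexp (\<Sum>i\<in>I. s i * y i))
      = (LINT z|(normal_prod K (\<lambda>_. 1) \<Otimes>\<^sub>M normal_prod I \<sigma>).
           iexp (\<Sum>i\<in>I. s i * (d i + (\<Sum>k\<in>K. L i k * fst z k) + snd z i)))"
    unfolding factor_law_def
    by (subst integral_distr) (measurable, simp add: case_prod_beta cong: sum.cong)
  also have "\<dots> = (LINT z|(normal_prod K (\<lambda>_. 1) \<Otimes>\<^sub>M normal_prod I \<sigma>). iexp (\<Sum>i\<in>I. s i * d i) *
      (iexp (\<Sum>k\<in>K. ?c k * fst z k) * iexp (\<Sum>i\<in>I. s i * snd z i)))"
    unfolding lin by (simp only: of_real_add distrib_left exp_add mult.assoc)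
  also have "\<dots> = iexp (\<Sum>i\<in>I. s i * d i) * (LINT z|(normal_prod K (\<lambda>_. 1) \<Otimes>\<^sub>M normal_prod I \<sigma>).
      (iexp (\<Sum>k\<in>K. ?c k * fst z k) * iexp (\<Sum>i\<in>I. s i * snd z i)))"
    by simp
  also have "(LINT z|(normal_prod K (\<lambda>_. 1) \<Otimes>\<^sub>M normal_prod I \<sigma>).
      (iexp (\<Sum>k\<in>K. ?c k * fst z k) * iexp (\<Sum>i\<in>I. s i * snd z i)))
      = (LINT \<eta>|normal_prod K (\<lambda>_. 1). LINT \<epsilon>|normal_prod I \<sigma>.
          iexp (\<Sum>k\<in>K. ?c k * \<eta> k) * iexp (\<Sum>i\<in>I. s i * \<epsilon> i))"
  proof (subst P.integral_fst'[symmetric])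
    show "integrable (normal_prod K (\<lambda>_. 1) \<Otimes>\<^sub>M normal_prod I \<sigma>)
        (\<lambda>z. iexp (\<Sum>k\<in>K. ?c k * fst z k) * iexp (\<Sum>i\<in>I. s i * snd z i))"
      by (rule P.integrable_const_bound[where B = 1]) (auto simp: norm_mult)
  qed simp
  also have "\<dots> = complex_of_real (exp (- (\<Sum>k\<in>K. (?c k)\<^sup>2) / 2))
      * complex_of_real (exp (- (\<Sum>i\<in>I. (\<sigma> i * s i)\<^sup>2) / 2))"
    by (simp only: integral_mult_right_zero integral_mult_left_zero
        normal_prod_characteristic_function[OF assms(1) assms(3)]
        std_normal_prod_characteristic_function[OF assms(2)])
  also have "\<dots> = complex_of_real (exp (- ((\<Sum>k\<in>K. (?c k)\<^sup>2) + (\<Sum>i\<in>I. (\<sigma> i * s i)\<^sup>2)) / 2))"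
    unfolding of_real_mult[symmetric] exp_add[symmetric] by (simp add: add_divide_distrib)
  finally show ?thesis
    unfolding factor_cov_quadratic_form[OF assms(1)] .
qed

text \<open>
  The modulus of the characteristic function is the exponential of a quadratic form in the
  covariances, which is recovered by evaluating it at unit vectors and at sums of two of them. The
  phase then yields the means.
\<close>

lemma factor_law_eqD:
  fixes d \<sigma> d' \<sigma>' :: "'i \<Rightarrow> real" and L L' :: "'i \<Rightarrow> 'k \<Rightarrow> real"
  assumes fin: "finite I" "finite K" and pos: "\<And>i. 0 < \<sigma> i" "\<And>i. 0 < \<sigma>' i"
    and eq: "factor_law I K d L \<sigma> = factor_law I K d' L' \<sigma>'"
  shows "i \<in> I \<Longrightarrow> d i = d' i"
    and "i \<in> I \<Longrightarrow> j \<in> I \<Longrightarrow> factor_cov K L \<sigma> i j = factor_cov K L' \<sigma>' i j"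
proof -
  let ?S = "factor_cov K L \<sigma>" and ?S' = "factor_cov K L' \<sigma>'"
  let ?Q = "\<lambda>S s. \<Sum>i\<in>I. \<Sum>j\<in>I. s i * s j * S i j :: real"
  have char: "iexp (\<Sum>i\<in>I. s i * d i) * complex_of_real (exp (- ?Q ?S s / 2))
      = iexp (\<Sum>i\<in>I. s i * d' i) * complex_of_real (exp (- ?Q ?S' s / 2))" for s
    using factor_law_characteristic_function[OF fin, where \<sigma> = \<sigma> and d = d and L = L and s = s, OF pos(1)]
      factor_law_characteristic_function[OF fin, where \<sigma> = \<sigma>' and d = d' and L = L' and s = s, OF pos(2)]
    unfolding eq by simp
  have Q: "?Q ?S s = ?Q ?S' s" for s
    using arg_cong[OF char[of s], of norm] by (simp add: norm_mult)
  have sym: "?S i j = ?S j i" "?S' i j = ?S' j i" for i j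
    by (simp_all add: factor_cov_def mult.commute)
  have unit: "(\<Sum>x\<in>I. \<Sum>y\<in>I. of_bool (x = i) * of_bool (y = j) * S x y) = S i j"
    if "i \<in> I" "j \<in> I" for S :: "'i \<Rightarrow> 'i \<Rightarrow> real" and i j
  proof -
    have "(\<Sum>x\<in>I. \<Sum>y\<in>I. of_bool (x = i) * of_bool (y = j) * S x y)
        = (\<Sum>x\<in>I. \<Sum>y\<in>I. if y = j then if x = i then S i j else 0 else 0)"
      by (intro sum.cong) auto
    with that fin(1) show ?thesis by simp
  qed
  have diag: "?S i i = ?S' i i" if "i \<in> I" for i
    using Q[of "\<lambda>x. of_bool (x = i)"] unfolding unit[OF that that] .
  have Q2: "?Q S (\<lambda>x. of_bool (x = i) + of_bool (x = j)) = S i i + S i j + (S j i + S j j)"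
    if "i \<in> I" "j \<in> I" for S :: "'i \<Rightarrow> 'i \<Rightarrow> real" and i j
    unfolding distrib_left distrib_right sum.distrib
    using that by (simp add: unit)
  show "?S i j = ?S' i j" if "i \<in> I" "j \<in> I" for i j
    using Q[of "\<lambda>x. of_bool (x = i) + of_bool (x = j)"] unfolding Q2[OF that]
    using diag that sym[of i j] by simp
  show "d i = d' i" if i: "i \<in> I" for i
  proof (rule ccontr)
    assume ne: "d i \<noteq> d' i"
    \<comment> \<open>At this frequency the two phases differ by \<open>pi\<close>, that is by the factor \<open>-1\<close>.\<close>
    let ?s = "\<lambda>x. of_bool (x = i) * (pi / (d i - d' i))"
    have "iexp (\<Sum>x\<in>I. ?s x * d x) = iexp (\<Sum>x\<in>I. ?s x * d' x)"
      using char[of ?s] unfolding Q[of ?s] by simp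
    moreover have "(\<Sum>x\<in>I. ?s x * f x) = pi / (d i - d' i) * f i" for f
    proof -
      have "(\<Sum>x\<in>I. ?s x * f x) = (\<Sum>x\<in>I. if x = i then pi / (d i - d' i) * f i else 0)"
        by (intro sum.cong) auto
      with i fin show ?thesis by simp
    qed
    ultimately have "iexp (pi / (d i - d' i) * d i) = iexp (pi / (d i - d' i) * d' i)"
      by (simp only:)
    then have "iexp (pi / (d i - d' i) * d i - pi / (d i - d' i) * d' i) = 1"
      by (simp add: right_diff_distrib exp_diff)
    also have "pi / (d i - d' i) * d i - pi / (d i - d' i) * d' i = pi"
      unfolding right_diff_distrib[symmetric] using ne by simp
    finally show False by simp
  qed
qed

section \<open>Linear factor models: mean and covariance determine the law\<close>

lemma nn_integral_normal_shift:
  fixes m \<sigma> :: real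
  assumes [measurable]: "B \<in> sets borel"
  shows "(\<integral>\<^sup>+e. indicator B (m + e) \<partial>density lborel (normal_density 0 \<sigma>))
    = (\<integral>\<^sup>+y. ennreal (normal_density 0 \<sigma> (y - m)) * indicator B y \<partial>lborel)"
proof -
  have "(\<integral>\<^sup>+e. indicator B (m + e) \<partial>density lborel (normal_density 0 \<sigma>))
      = (\<integral>\<^sup>+e. ennreal (normal_density 0 \<sigma> e) * indicator B (m + e) \<partial>lborel)"
    by (subst nn_integral_density) auto
  also have "\<dots> = (\<integral>\<^sup>+y. ennreal (normal_density 0 \<sigma> (y - m)) * indicator B y \<partial>lborel)"
    by (subst nn_integral_real_affine[where c = 1 and t = "- m"]) auto
  finally show ?thesis .
qed

text \<open>
  The density of the observed vector, as the average over the factors of the conditional density,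
  in which the items are independent.
\<close>

definition factor_density :: "'i set \<Rightarrow> 'k set \<Rightarrow> ('i \<Rightarrow> real) \<Rightarrow> ('i \<Rightarrow> 'k \<Rightarrow> real) \<Rightarrow> ('i \<Rightarrow> real) \<Rightarrow> ('i \<Rightarrow> real) \<Rightarrow> real" where
  "factor_density I K d L \<sigma> y =
     (LINT \<eta>|normal_prod K (\<lambda>_. 1).
       (\<Prod>i\<in>I. normal_density 0 (\<sigma> i) (y i - (d i + (\<Sum>k\<in>K. L i k * \<eta> k)))))"

lemma normal_density_le:
  fixes \<sigma> u :: real
  assumes "0 < \<sigma>"
  shows "normal_density 0 \<sigma> u \<le> 1 / (sqrt (2 * pi) * \<sigma>)"
  using assms by (simp add: normal_density_def real_sqrt_mult divide_le_cancel mult_ac divide_simps)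

text \<open>
  Given the factors, the probability of a box is a product of one-dimensional integrals. Tonelli's
  theorem moves the average over the factors inside.
\<close>

lemma emeasure_factor_law_box:
  fixes d \<sigma> :: "'i \<Rightarrow> real" and L :: "'i \<Rightarrow> 'k \<Rightarrow> real"
  assumes fin: "finite I" "finite K" and pos: "\<And>i. 0 < \<sigma> i"
    and B: "\<And>i. i \<in> I \<Longrightarrow> B i \<in> sets borel"
  shows "emeasure (factor_law I K d L \<sigma>) (Pi\<^sub>E I B)
    = (\<integral>\<^sup>+y. ennreal (factor_density I K d L \<sigma> y) * indicator (Pi\<^sub>E I B) y \<partial>(\<Pi>\<^sub>M i\<in>I. lborel))"
proof -
  interpret E: prob_space "normal_prod K (\<lambda>_. 1)" by (rule prob_space_normal_prod) simp
  interpret U: prob_space "normal_prod I \<sigma>" by (rule prob_space_normal_prod) fact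
  interpret P: pair_prob_space "normal_prod K (\<lambda>_. 1)" "normal_prod I \<sigma>" ..
  interpret N: product_sigma_finite "\<lambda>i. density lborel (normal_density 0 (\<sigma> i))"
    by (rule product_sigma_finite_normal) fact
  interpret Leb: product_sigma_finite "\<lambda>_::'i. lborel :: real measure"
    by (simp add: product_sigma_finite_def lborel.sigma_finite_measure_axioms)
  interpret LebI: finite_product_sigma_finite "\<lambda>_::'i. lborel :: real measure" I
    by standard fact
  interpret Q: pair_sigma_finite "normal_prod K (\<lambda>_. 1)" "\<Pi>\<^sub>M i\<in>I. lborel :: real measure" ..
  let ?m = "\<lambda>\<eta> i. d i + (\<Sum>k\<in>K. L i k * \<eta> k)"
  let ?B = "Pi\<^sub>E I B"
  have [measurable]: "?B \<in> sets (\<Pi>\<^sub>M i\<in>I. borel)"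
    using fin B by (intro sets_PiM_I_finite) auto
  have [measurable_cong]: "sets (\<Pi>\<^sub>M i\<in>I. lborel :: real measure) = sets (\<Pi>\<^sub>M i\<in>I. borel)"
    by (intro sets_PiM_cong) auto
  have ind: "indicator ?B (\<lambda>i\<in>I. f i) = (\<Prod>i\<in>I. indicator (B i) (f i) :: ennreal)" for f
    using fin(1) by (auto simp: indicator_def PiE_iff prod_zero_iff Ball_def)
  have ind': "indicator ?B y = (\<Prod>i\<in>I. indicator (B i) (y i) :: ennreal)" if "y \<in> extensional I" for y
    using ind[of y] that by (simp add: extensional_restrict)
  have "emeasure (factor_law I K d L \<sigma>) ?B = (\<integral>\<^sup>+y. indicator ?B y \<partial>factor_law I K d L \<sigma>)"
    by (simp add: factor_law_def)
  also have "\<dots> = (\<integral>\<^sup>+z. indicator ?B (\<lambda>i\<in>I. ?m (fst z) i + snd z i)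
      \<partial>(normal_prod K (\<lambda>_. 1) \<Otimes>\<^sub>M normal_prod I \<sigma>))"
    unfolding factor_law_def by (subst nn_integral_distr) (measurable, simp add: case_prod_beta)
  also have "\<dots> = (\<integral>\<^sup>+\<eta>. \<integral>\<^sup>+\<epsilon>. indicator ?B (\<lambda>i\<in>I. ?m \<eta> i + \<epsilon> i) \<partial>normal_prod I \<sigma> \<partial>normal_prod K (\<lambda>_. 1))"
  proof (subst U.nn_integral_fst[symmetric])
    have "(\<lambda>z. \<lambda>i\<in>I. ?m (fst z) i + snd z i) \<in> normal_prod K (\<lambda>_. 1) \<Otimes>\<^sub>M normal_prod I \<sigma> \<rightarrow>\<^sub>M (\<Pi>\<^sub>M i\<in>I. borel)"
      using factor_response_measurable[where I = I and d = d and K = K and L = L and \<sigma> = \<sigma>] by (simp add: case_prod_beta)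
    then show "(\<lambda>z. indicator ?B (\<lambda>i\<in>I. ?m (fst z) i + snd z i) :: ennreal)
        \<in> borel_measurable (normal_prod K (\<lambda>_. 1) \<Otimes>\<^sub>M normal_prod I \<sigma>)"
      by (rule measurable_compose) measurable
  qed simp
  also have "\<dots> = (\<integral>\<^sup>+\<eta>. \<integral>\<^sup>+y. (\<Prod>i\<in>I. ennreal (normal_density 0 (\<sigma> i) (y i - ?m \<eta> i))) * indicator ?B y
      \<partial>(\<Pi>\<^sub>M i\<in>I. lborel) \<partial>normal_prod K (\<lambda>_. 1))"
  proof (rule nn_integral_cong)
    fix \<eta> :: "'k \<Rightarrow> real"
    have "(\<integral>\<^sup>+\<epsilon>. indicator ?B (\<lambda>i\<in>I. ?m \<eta> i + \<epsilon> i) \<partial>normal_prod I \<sigma>)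
        = (\<integral>\<^sup>+\<epsilon>. (\<Prod>i\<in>I. indicator (B i) (?m \<eta> i + \<epsilon> i)) \<partial>normal_prod I \<sigma>)"
      unfolding ind ..
    also have "\<dots> = (\<Prod>i\<in>I. \<integral>\<^sup>+e. indicator (B i) (?m \<eta> i + e) \<partial>density lborel (normal_density 0 (\<sigma> i)))"
    proof (rule N.product_nn_integral_prod[OF fin(1)])
      fix i assume "i \<in> I"
      note [measurable] = B[OF this]
      show "(\<lambda>e. indicator (B i) (?m \<eta> i + e)) \<in> borel_measurable (density lborel (normal_density 0 (\<sigma> i)))"
        by measurable
    qed
    also have "\<dots> = (\<Prod>i\<in>I. \<integral>\<^sup>+y. ennreal (normal_density 0 (\<sigma> i) (y - ?m \<eta> i)) * indicator (B i) y \<partial>lborel)"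
      by (intro prod.cong refl nn_integral_normal_shift B)
    also have "\<dots> = (\<integral>\<^sup>+y. (\<Prod>i\<in>I. ennreal (normal_density 0 (\<sigma> i) (y i - ?m \<eta> i)) * indicator (B i) (y i))
        \<partial>(\<Pi>\<^sub>M i\<in>I. lborel))"
    proof (rule Leb.product_nn_integral_prod[OF fin(1), symmetric])
      fix i assume "i \<in> I"
      note [measurable] = B[OF this]
      show "(\<lambda>y. ennreal (normal_density 0 (\<sigma> i) (y - ?m \<eta> i)) * indicator (B i) y) \<in> borel_measurable lborel"
        by measurable
    qed
    also have "\<dots> = (\<integral>\<^sup>+y. (\<Prod>i\<in>I. ennreal (normal_density 0 (\<sigma> i) (y i - ?m \<eta> i))) * indicator ?B y
        \<partial>(\<Pi>\<^sub>M i\<in>I. lborel))"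
      by (intro nn_integral_cong) (simp add: prod.distrib ind' space_PiM PiE_iff)
    finally show "(\<integral>\<^sup>+\<epsilon>. indicator ?B (\<lambda>i\<in>I. ?m \<eta> i + \<epsilon> i) \<partial>normal_prod I \<sigma>) = \<dots>" .
  qed
  also have "\<dots> = (\<integral>\<^sup>+y. \<integral>\<^sup>+\<eta>. (\<Prod>i\<in>I. ennreal (normal_density 0 (\<sigma> i) (y i - ?m \<eta> i))) * indicator ?B y
      \<partial>normal_prod K (\<lambda>_. 1) \<partial>(\<Pi>\<^sub>M i\<in>I. lborel))"
    by (rule Q.Fubini'[symmetric]) measurable
  also have "\<dots> = (\<integral>\<^sup>+y. ennreal (factor_density I K d L \<sigma> y) * indicator ?B y \<partial>(\<Pi>\<^sub>M i\<in>I. lborel))"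
  proof (rule nn_integral_cong)
    fix y :: "'i \<Rightarrow> real"
    have "integrable (normal_prod K (\<lambda>_. 1)) (\<lambda>\<eta>. \<Prod>i\<in>I. normal_density 0 (\<sigma> i) (y i - ?m \<eta> i))"
    proof (rule E.integrable_const_bound[where B = "\<Prod>i\<in>I. 1 / (sqrt (2 * pi) * \<sigma> i)"])
      show "AE \<eta> in normal_prod K (\<lambda>_. 1). norm (\<Prod>i\<in>I. normal_density 0 (\<sigma> i) (y i - ?m \<eta> i))
          \<le> (\<Prod>i\<in>I. 1 / (sqrt (2 * pi) * \<sigma> i))"
        unfolding prod_norm[symmetric] using pos by (intro AE_I2 prod_mono) (auto intro: normal_density_le)
    qed measurable
    then have 1: "(\<integral>\<^sup>+\<eta>. (\<Prod>i\<in>I. ennreal (normal_density 0 (\<sigma> i) (y i - ?m \<eta> i))) \<partial>normal_prod K (\<lambda>_. 1))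
        = ennreal (factor_density I K d L \<sigma> y)"
      unfolding factor_density_def by (simp add: prod_ennreal nn_integral_eq_integral prod_nonneg)
    have "(\<lambda>\<eta>. \<Prod>i\<in>I. ennreal (normal_density 0 (\<sigma> i) (y i - ?m \<eta> i))) \<in> borel_measurable (normal_prod K (\<lambda>_. 1))"
      by measurable
    then show "(\<integral>\<^sup>+\<eta>. (\<Prod>i\<in>I. ennreal (normal_density 0 (\<sigma> i) (y i - ?m \<eta> i))) * indicator ?B y
        \<partial>normal_prod K (\<lambda>_. 1)) = ennreal (factor_density I K d L \<sigma> y) * indicator ?B y"
      by (simp only: nn_integral_multc 1)
  qed
  finally show ?thesis .
qed

text \<open>
  Each conditional normal density is replaced by its Fourier integral, which brings the factors into
  the exponent. Fubini's theorem then allows averaging over the factors first, and this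
  produces their characteristic function. The right-hand side involves loadings and standard
  deviations through \<open>factor_cov\<close> only.
\<close>

lemma factor_density_Fourier:
  fixes d \<sigma> y :: "'i \<Rightarrow> real" and L :: "'i \<Rightarrow> 'k \<Rightarrow> real"
  assumes fin: "finite I" "finite K" and pos: "\<And>i. 0 < \<sigma> i"
  shows "complex_of_real (factor_density I K d L \<sigma> y)
    = (LINT s|(\<Pi>\<^sub>M i\<in>I. lborel). iexp (\<Sum>i\<in>I. s i * (y i - d i)) *
        complex_of_real (exp (- (\<Sum>i\<in>I. \<Sum>j\<in>I. s i * s j * factor_cov K L \<sigma> i j) / 2) / (2 * pi) ^ card I))"
proof -
  interpret E: prob_space "normal_prod K (\<lambda>_. 1)" by (rule prob_space_normal_prod) simp
  interpret Leb: product_sigma_finite "\<lambda>_::'i. lborel :: real measure"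
    by (simp add: product_sigma_finite_def lborel.sigma_finite_measure_axioms)
  interpret LebI: finite_product_sigma_finite "\<lambda>_::'i. lborel :: real measure" I
    by standard fact
  interpret Q: pair_sigma_finite "normal_prod K (\<lambda>_. 1)" "\<Pi>\<^sub>M i\<in>I. lborel :: real measure" ..
  have [measurable_cong]: "sets (\<Pi>\<^sub>M i\<in>I. lborel :: real measure) = sets (\<Pi>\<^sub>M i\<in>I. borel)"
    by (intro sets_PiM_cong) auto
  let ?m = "\<lambda>\<eta> i. d i + (\<Sum>k\<in>K. L i k * \<eta> k)"
  let ?c = "\<lambda>s k. \<Sum>i\<in>I. s i * L i k"
  define k where "k i s = exp (- (\<sigma> i * s)\<^sup>2 / 2) / (2 * pi)" for i and s :: real
  have [measurable]: "k i \<in> borel_measurable borel" for i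
    unfolding k_def by measurable
  have k_pos: "0 \<le> k i s" for i s
    by (simp add: k_def)
  let ?h = "\<lambda>\<eta> s. \<Prod>i\<in>I. complex_of_real (k i (s i)) * iexp (s i * (y i - ?m \<eta> i))"
  have h_int: "integrable (\<Pi>\<^sub>M i\<in>I. lborel) (?h \<eta>)" for \<eta>
    using normal_density_Fourier(1)[OF pos]
    by (intro Leb.product_integrable_prod[OF fin(1), where f = "\<lambda>i s. complex_of_real (k i s) * iexp (s * (y i - ?m \<eta> i))"])
      (simp only: k_def)
  have h_norm: "norm (?h \<eta> s) = (\<Prod>i\<in>I. k i (s i))" for \<eta> s
    using k_pos by (simp add: norm_mult flip: prod_norm)
  have h: "?h \<eta> s = (\<Prod>i\<in>I. complex_of_real (k i (s i))) *
      (iexp (\<Sum>i\<in>I. s i * (y i - d i)) * iexp (\<Sum>k\<in>K. - ?c s k * \<eta> k))" for \<eta> s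
  proof -
    have "(\<Prod>i\<in>I. iexp (s i * (y i - ?m \<eta> i))) = iexp (\<Sum>i\<in>I. s i * (y i - ?m \<eta> i))"
      using fin by (simp add: sum_distrib_left exp_sum)
    also have "(\<Sum>i\<in>I. s i * (y i - ?m \<eta> i)) = (\<Sum>i\<in>I. s i * (y i - d i)) + (\<Sum>k\<in>K. - ?c s k * \<eta> k)"
    proof -
      have "(\<Sum>i\<in>I. s i * (\<Sum>k\<in>K. L i k * \<eta> k)) = (\<Sum>k\<in>K. ?c s k * \<eta> k)"
        unfolding sum_distrib_left sum_distrib_right by (subst sum.swap) (simp add: mult_ac)
      then show ?thesis
        by (simp add: algebra_simps sum.distrib sum_subtractf sum_negf)
    qed
    also have "iexp \<dots> = iexp (\<Sum>i\<in>I. s i * (y i - d i)) * iexp (\<Sum>k\<in>K. - ?c s k * \<eta> k)"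
      by (simp only: of_real_add distrib_left exp_add)
    finally show ?thesis
      unfolding prod.distrib by simp
  qed
  have "complex_of_real (factor_density I K d L \<sigma> y)
      = (LINT \<eta>|normal_prod K (\<lambda>_. 1). (\<Prod>i\<in>I. complex_of_real (normal_density 0 (\<sigma> i) (y i - ?m \<eta> i))))"
    unfolding factor_density_def integral_complex_of_real[symmetric] of_real_prod ..
  also have "\<dots> = (LINT \<eta>|normal_prod K (\<lambda>_. 1). LINT s|(\<Pi>\<^sub>M i\<in>I. lborel). ?h \<eta> s)"
  proof (rule Bochner_Integration.integral_cong[OF refl])
    fix \<eta>
    show "(\<Prod>i\<in>I. complex_of_real (normal_density 0 (\<sigma> i) (y i - ?m \<eta> i)))
        = (LINT s|(\<Pi>\<^sub>M i\<in>I. lborel). ?h \<eta> s)"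
      using normal_density_Fourier(1)[OF pos]
      by (subst Leb.product_integral_prod[OF fin(1), where f = "\<lambda>i s. complex_of_real (k i s) * iexp (s * (y i - ?m \<eta> i))"])
        (simp_all only: k_def normal_density_Fourier(2)[OF pos])
  qed
  also have "\<dots> = (LINT s|(\<Pi>\<^sub>M i\<in>I. lborel). LINT \<eta>|normal_prod K (\<lambda>_. 1). ?h \<eta> s)"
  proof (rule Q.Fubini_integral[symmetric], rule Q.Fubini_integrable)
    show "(\<lambda>(\<eta>, s). ?h \<eta> s) \<in> borel_measurable (normal_prod K (\<lambda>_. 1) \<Otimes>\<^sub>M (\<Pi>\<^sub>M i\<in>I. lborel))"
      by measurable
    show "integrable (normal_prod K (\<lambda>_. 1)) (\<lambda>\<eta>. LINT s|(\<Pi>\<^sub>M i\<in>I. lborel). norm (case (\<eta>, s) of (\<eta>, s) \<Rightarrow> ?h \<eta> s))"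
      unfolding prod.case h_norm by simp
    show "AE \<eta> in normal_prod K (\<lambda>_. 1). integrable (\<Pi>\<^sub>M i\<in>I. lborel) (\<lambda>s. case (\<eta>, s) of (\<eta>, s) \<Rightarrow> ?h \<eta> s)"
      using h_int by simp
  qed
  also have "\<dots> = (LINT s|(\<Pi>\<^sub>M i\<in>I. lborel). iexp (\<Sum>i\<in>I. s i * (y i - d i)) *
        complex_of_real (exp (- (\<Sum>i\<in>I. \<Sum>j\<in>I. s i * s j * factor_cov K L \<sigma> i j) / 2) / (2 * pi) ^ card I))"
  proof (rule Bochner_Integration.integral_cong[OF refl])
    fix s :: "'i \<Rightarrow> real"
    have "(\<Prod>i\<in>I. complex_of_real (k i (s i))) = complex_of_real (\<Prod>i\<in>I. k i (s i))"
      by simp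
    also have "(\<Prod>i\<in>I. k i (s i)) = exp (- (\<Sum>i\<in>I. (\<sigma> i * s i)\<^sup>2) / 2) / (2 * pi) ^ card I"
      using fin(1) by (simp add: k_def prod_dividef exp_sum sum_negf sum_divide_distrib flip: exp_sum)
    finally have kp: "(\<Prod>i\<in>I. complex_of_real (k i (s i))) = complex_of_real \<dots>" .
    have "(LINT \<eta>|normal_prod K (\<lambda>_. 1). ?h \<eta> s)
      = complex_of_real (exp (- (\<Sum>i\<in>I. (\<sigma> i * s i)\<^sup>2) / 2) / (2 * pi) ^ card I) *
        (iexp (\<Sum>i\<in>I. s i * (y i - d i)) * complex_of_real (exp (- (\<Sum>k\<in>K. (- ?c s k)\<^sup>2) / 2)))"
      unfolding h kp by (simp only: integral_mult_right_zero
        std_normal_prod_characteristic_function[OF fin(2)])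
    also have "\<dots> = iexp (\<Sum>i\<in>I. s i * (y i - d i)) *
        complex_of_real (exp (- (\<Sum>i\<in>I. (\<sigma> i * s i)\<^sup>2) / 2) * exp (- (\<Sum>k\<in>K. (?c s k)\<^sup>2) / 2) / (2 * pi) ^ card I)"
      by simp
    also have "exp (- (\<Sum>i\<in>I. (\<sigma> i * s i)\<^sup>2) / 2) * exp (- (\<Sum>k\<in>K. (?c s k)\<^sup>2) / 2)
        = exp (- ((\<Sum>k\<in>K. (?c s k)\<^sup>2) + (\<Sum>i\<in>I. (\<sigma> i * s i)\<^sup>2)) / 2)"
      by (simp add: add_divide_distrib add.commute flip: exp_add)
    finally show "(LINT \<eta>|normal_prod K (\<lambda>_. 1). ?h \<eta> s) = iexp (\<Sum>i\<in>I. s i * (y i - d i)) *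
        complex_of_real (exp (- (\<Sum>i\<in>I. \<Sum>j\<in>I. s i * s j * factor_cov K L \<sigma> i j) / 2) / (2 * pi) ^ card I)"
      unfolding factor_cov_quadratic_form[OF fin(1)] .
  qed
  finally show ?thesis .
qed

lemma factor_law_eqI:
  fixes d \<sigma> d' \<sigma>' :: "'i \<Rightarrow> real" and L L' :: "'i \<Rightarrow> 'k \<Rightarrow> real"
  assumes fin: "finite I" "finite K" and pos: "\<And>i. 0 < \<sigma> i" "\<And>i. 0 < \<sigma>' i"
    and d: "\<And>i. i \<in> I \<Longrightarrow> d i = d' i"
    and cov: "\<And>i j. i \<in> I \<Longrightarrow> j \<in> I \<Longrightarrow> factor_cov K L \<sigma> i j = factor_cov K L' \<sigma>' i j"
  shows "factor_law I K d L \<sigma> = factor_law I K d' L' \<sigma>'"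
proof (rule measure_eqI_PiM_finite)
  have "complex_of_real (factor_density I K d L \<sigma> y) = complex_of_real (factor_density I K d' L' \<sigma>' y)" for y
    unfolding factor_density_Fourier[OF fin, where \<sigma> = \<sigma>, OF pos(1)]
      factor_density_Fourier[OF fin, where \<sigma> = \<sigma>', OF pos(2)]
    using d cov by (simp cong: sum.cong)
  then have "factor_density I K d L \<sigma> = factor_density I K d' L' \<sigma>'"
    by auto
  then show "emeasure (factor_law I K d L \<sigma>) (Pi\<^sub>E I B) = emeasure (factor_law I K d' L' \<sigma>') (Pi\<^sub>E I B)"
    if "\<And>i. i \<in> I \<Longrightarrow> B i \<in> sets borel" for B
    using that by (simp add: emeasure_factor_law_box[OF fin, where \<sigma> = \<sigma>, OF pos(1)]
      emeasure_factor_law_box[OF fin, where \<sigma> = \<sigma>', OF pos(2)])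
  interpret E: prob_space "normal_prod K (\<lambda>_. 1)" by (rule prob_space_normal_prod) simp
  interpret U: prob_space "normal_prod I \<sigma>" by (rule prob_space_normal_prod) fact
  interpret P: pair_prob_space "normal_prod K (\<lambda>_. 1)" "normal_prod I \<sigma>" ..
  interpret prob_space "factor_law I K d L \<sigma>"
    unfolding factor_law_def by (rule P.prob_space_distr) measurable
  show "emeasure (factor_law I K d L \<sigma>) (Pi\<^sub>E I (\<lambda>_. UNIV)) \<noteq> \<infinity>" for i :: nat
    by simp
  show "range (\<lambda>_::nat. Pi\<^sub>E I (\<lambda>_. UNIV)) \<subseteq> prod_algebra I (\<lambda>_. borel :: real measure)"
    using fin(1) by (auto intro!: prod_algebraI_finite)
qed (use fin in \<open>auto simp: factor_law_def space_PiM\<close>)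

section \<open>The covariance structure of the bifactor model\<close>

definition bifactor_cov :: "(nat \<Rightarrow> nat) \<Rightarrow> real mat \<Rightarrow> real vec \<Rightarrow> nat \<Rightarrow> nat \<Rightarrow> real" where
  "bifactor_cov t A l i j =
     A $$ (i, 0) * A $$ (j, 0) + (if t i = t j then A $$ (i, t i) * A $$ (j, t j) else 0)
     + (if i = j then l $ i else 0)"

lemma param_space_zero:
  assumes "(A, d, l) \<in> bifactor_param_space J G t" "j < J" "g \<in> {1..G}" "t j \<noteq> g"
  shows "A $$ (j, g) = 0"
  using assms by (simp add: bifactor_param_space_def)

lemma param_space_variance_pos:
  assumes "(A, d, l) \<in> bifactor_param_space J G t" "j < J"
  shows "0 < l $ j"
  using assms by (simp add: bifactor_param_space_def)

lemma sum_main_and_testlet_factor: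
  assumes t: "t ` {..<J} = {1..G}" and \<theta>: "(A, d, l) \<in> bifactor_param_space J G t" and j: "j < J"
  shows "(\<Sum>k\<in>{0..G}. A $$ (j, k) * f k) = A $$ (j, 0) * f 0 + A $$ (j, t j) * f (t j)"
proof -
  have tj: "t j \<in> {1..G}" using t j by blast
  have "(\<Sum>k\<in>{0..G}. A $$ (j, k) * f k) = (\<Sum>k\<in>{0, t j}. A $$ (j, k) * f k)"
    using \<theta> tj j by (intro sum.mono_neutral_right) (auto simp: bifactor_param_space_def)
  with tj show ?thesis by simp
qed

lemma bifactor_law_eq_factor_law:
  assumes t: "t ` {..<J} = {1..G}" and \<theta>: "(A, d, l) \<in> bifactor_param_space J G t"
  shows "bifactor_law J G t (A, d, l) = factor_law {..<J} {0..G} (\<lambda>j. d $ j) (\<lambda>j k. A $$ (j, k))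
    (\<lambda>j. if j < J then sqrt (l $ j) else 1)"
proof -
  have "bifactor_latent_law J G l = normal_prod {0..G} (\<lambda>_. 1) \<Otimes>\<^sub>M
      normal_prod {..<J} (\<lambda>j. if j < J then sqrt (l $ j) else 1)"
    unfolding bifactor_latent_law_def by (intro arg_cong2[where f = pair_measure] PiM_cong) auto
  moreover have "bifactor_response J t A d = (\<lambda>(\<eta>, \<epsilon>). \<lambda>j\<in>{..<J}. d $ j + (\<Sum>k\<in>{0..G}. A $$ (j, k) * \<eta> k) + \<epsilon> j)"
    unfolding bifactor_response_def
    by (intro ext) (simp add: sum_main_and_testlet_factor[OF assms] case_prod_beta restrict_def add.assoc)
  ultimately show ?thesis
    by (simp add: bifactor_law_def factor_law_def)
qed

lemma factor_cov_eq_bifactor_cov: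
  assumes t: "t ` {..<J} = {1..G}" and \<theta>: "(A, d, l) \<in> bifactor_param_space J G t"
    and i: "i < J" and j: "j < J"
  shows "factor_cov {0..G} (\<lambda>j k. A $$ (j, k)) (\<lambda>j. if j < J then sqrt (l $ j) else 1) i j = bifactor_cov t A l i j"
proof -
  have "A $$ (j, t i) = 0" if "t i \<noteq> t j"
    using \<theta> that t i j by (auto simp: bifactor_param_space_def)
  moreover have "l $ j > 0"
    using \<theta> j by (auto simp: bifactor_param_space_def)
  ultimately show ?thesis
    using i j by (simp add: factor_cov_def bifactor_cov_def sum_main_and_testlet_factor[OF t \<theta>])
qed

theorem bifactor_law_eq_iff:
  assumes t: "t ` {..<J} = {1..G}"
    and \<theta>: "(A, d, l) \<in> bifactor_param_space J G t" and \<theta>': "(A', d', l') \<in> bifactor_param_space J G t"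
  shows "bifactor_law J G t (A', d', l') = bifactor_law J G t (A, d, l) \<longleftrightarrow>
    d' = d \<and> (\<forall>i<J. \<forall>j<J. bifactor_cov t A' l' i j = bifactor_cov t A l i j)"
proof -
  let ?\<sigma> = "\<lambda>l j. if j < J then sqrt (l $ j) else 1 :: real"
  have pos: "0 < ?\<sigma> l j" "0 < ?\<sigma> l' j" for j
    using \<theta> \<theta>' by (auto simp: bifactor_param_space_def)
  have dim: "dim_vec d = J" "dim_vec d' = J"
    using \<theta> \<theta>' by (auto simp: bifactor_param_space_def)
  show ?thesis
    unfolding bifactor_law_eq_factor_law[OF t \<theta>] bifactor_law_eq_factor_law[OF t \<theta>']
  proof (intro iffI conjI allI impI)
    assume eq: "factor_law {..<J} {0..G} (($) d') (\<lambda>j k. A' $$ (j, k)) (?\<sigma> l')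
      = factor_law {..<J} {0..G} (($) d) (\<lambda>j k. A $$ (j, k)) (?\<sigma> l)"
    note D = factor_law_eqD[OF finite_lessThan finite_atLeastAtMost pos(2) pos(1) eq]
    show "d' = d" using D(1) dim by (intro eq_vecI) auto
    show "bifactor_cov t A' l' i j = bifactor_cov t A l i j" if "i < J" "j < J" for i j
      using D(2)[of i j] that
      by (simp only: factor_cov_eq_bifactor_cov[OF t \<theta>] factor_cov_eq_bifactor_cov[OF t \<theta>'] lessThan_iff)
  next
    assume "d' = d \<and> (\<forall>i<J. \<forall>j<J. bifactor_cov t A' l' i j = bifactor_cov t A l i j)"
    then show "factor_law {..<J} {0..G} (($) d') (\<lambda>j k. A' $$ (j, k)) (?\<sigma> l')
      = factor_law {..<J} {0..G} (($) d) (\<lambda>j k. A $$ (j, k)) (?\<sigma> l)"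
      by (intro factor_law_eqI finite_lessThan finite_atLeastAtMost pos)
        (simp_all only: factor_cov_eq_bifactor_cov[OF t \<theta>] factor_cov_eq_bifactor_cov[OF t \<theta>'] lessThan_iff)
  qed
qed

section \<open>Rank of two columns\<close>

lemma mult_two_columns_eq_zero_iff:
  fixes M :: "real mat"
  assumes M: "M \<in> carrier_mat n 2" and v: "v \<in> carrier_vec 2"
  shows "M *\<^sub>v v = 0\<^sub>v n \<longleftrightarrow> (\<forall>p<n. M $$ (p, 0) * v $ 0 + M $$ (p, 1) * v $ 1 = 0)"
proof -
  have entry: "(M *\<^sub>v v) $ p = M $$ (p, 0) * v $ 0 + M $$ (p, 1) * v $ 1" if "p < n" for p
  proof -
    have "(M *\<^sub>v v) $ p = row M p \<bullet> v" using M v that by simp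
    also have "\<dots> = (\<Sum>i\<in>{0..<2}. row M p $ i * v $ i)" using v by (simp add: scalar_prod_def)
    also have "{0..<2::nat} = {0, 1}" by auto
    finally show ?thesis using M that by simp
  qed
  have "dim_vec (M *\<^sub>v v) = n" using M by simp
  then have "M *\<^sub>v v = 0\<^sub>v n \<longleftrightarrow> (\<forall>p<n. (M *\<^sub>v v) $ p = 0)"
    by (metis eq_vecI index_zero_vec)
  with entry show ?thesis by simp
qed

text \<open>
  Rank 2 means that the two columns are linearly independent. A nonzero minor excludes a nontrivial
  relation between them; if all minors vanish, any nonzero row \<open>(x, y)\<close> provides the relation \<open>(y, -x)\<close>.
\<close>

lemma rank_two_columns_iff:
  fixes M :: "real mat"
  assumes M: "M \<in> carrier_mat n 2"
  shows "vec_space.rank n M = 2 \<longleftrightarrow> (\<exists>p<n. \<exists>q<n. M $$ (p, 0) * M $$ (q, 1) \<noteq> M $$ (q, 0) * M $$ (p, 1))"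
proof
  interpret vec_space "TYPE(real)" n .
  note mult = mult_two_columns_eq_zero_iff[OF M]
  {
    assume rank: "rank M = 2"
    have "distinct (cols M)"
    proof (rule ccontr)
      assume "\<not> distinct (cols M)"
      then have "card (set (cols M)) < 2"
        using M card_distinct[of "cols M"] card_length[of "cols M"] by fastforce
      moreover obtain S where S: "maximal S (\<lambda>T. T \<subseteq> set (cols M) \<and> lin_indpt T)"
        using maximal_exists_superset[of "set (cols M)" "\<lambda>T. T \<subseteq> set (cols M) \<and> lin_indpt T" "{}"]
        by (auto simp: lin_dep_def)
      moreover have "card S \<le> card (set (cols M))"
        using S by (simp add: card_mono maximal_def)
      ultimately show False
        using rank rank_card_indpt[OF M S] by simp
    qed
    show "\<exists>p<n. \<exists>q<n. M $$ (p, 0) * M $$ (q, 1) \<noteq> M $$ (q, 0) * M $$ (p, 1)"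
    proof (rule ccontr)
      assume *: "\<not> ?thesis"
      have "\<exists>v \<in> carrier_vec 2. v \<noteq> 0\<^sub>v 2 \<and> M *\<^sub>v v = 0\<^sub>v n"
      proof (cases "\<exists>p<n. M $$ (p, 0) \<noteq> 0 \<or> M $$ (p, 1) \<noteq> 0")
        case True
        then obtain p where p: "p < n" "M $$ (p, 0) \<noteq> 0 \<or> M $$ (p, 1) \<noteq> 0" by auto
        let ?v = "vec 2 (\<lambda>i. if i = 0 then M $$ (p, 1) else - M $$ (p, 0))"
        have v: "?v \<in> carrier_vec 2" "?v $ 0 = M $$ (p, 1)" "?v $ 1 = - M $$ (p, 0)"
          by simp_all
        have "?v \<noteq> 0\<^sub>v 2"
        proof
          assume z: "?v = 0\<^sub>v 2"
          have "?v $ 0 = 0" "?v $ 1 = 0" unfolding z by simp_all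
          with p(2) v(2,3) show False by simp
        qed
        moreover have "M *\<^sub>v ?v = 0\<^sub>v n"
          unfolding mult[OF v(1)] v(2,3)
        proof (intro allI impI)
          fix q assume "q < n"
          with * p(1) have "M $$ (p, 0) * M $$ (q, 1) = M $$ (q, 0) * M $$ (p, 1)" by blast
          then show "M $$ (q, 0) * M $$ (p, 1) + M $$ (q, 1) * - M $$ (p, 0) = 0" by (simp add: mult.commute)
        qed
        ultimately show ?thesis using v(1) by blast
      next
        case False
        then have "M *\<^sub>v unit_vec 2 0 = 0\<^sub>v n"
          by (subst mult) auto
        then show ?thesis
          by (intro bexI[of _ "unit_vec 2 0"]) auto
      qed
      then show False
        using lin_depI[OF M] full_rank_lin_indpt[OF M rank] \<open>distinct (cols M)\<close> by blast
    qed
  }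
  assume "\<exists>p<n. \<exists>q<n. M $$ (p, 0) * M $$ (q, 1) \<noteq> M $$ (q, 0) * M $$ (p, 1)"
  then obtain p q where pq: "p < n" "q < n" "M $$ (p, 0) * M $$ (q, 1) \<noteq> M $$ (q, 0) * M $$ (p, 1)"
    by blast
  have dist: "distinct (cols M)"
  proof -
    have "col M 0 \<noteq> col M 1"
    proof
      assume eq: "col M 0 = col M 1"
      have "M $$ (r, 0) = M $$ (r, 1)" if "r < n" for r
        using arg_cong[OF eq, of "\<lambda>v. v $ r"] that M by simp
      with pq show False by simp
    qed
    moreover have "cols M = [col M 0, col M 1]"
      using M by (simp add: cols_def numeral_2_eq_2)
    ultimately show ?thesis by simp
  qed
  moreover have "lin_indpt (set (cols M))"
  proof
    assume "lin_dep (set (cols M))"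
    then obtain v where v: "v \<in> carrier_vec 2" "v \<noteq> 0\<^sub>v 2" "M *\<^sub>v v = 0\<^sub>v n"
      using lin_depE[OF M _ dist] by blast
    let ?D = "M $$ (p, 0) * M $$ (q, 1) - M $$ (q, 0) * M $$ (p, 1)"
    have e: "M $$ (p, 0) * v $ 0 + M $$ (p, 1) * v $ 1 = 0" "M $$ (q, 0) * v $ 0 + M $$ (q, 1) * v $ 1 = 0"
      using v(3) pq unfolding mult[OF v(1)] by auto
    have "?D * v $ 0 = (M $$ (p, 0) * v $ 0 + M $$ (p, 1) * v $ 1) * M $$ (q, 1)
        - (M $$ (q, 0) * v $ 0 + M $$ (q, 1) * v $ 1) * M $$ (p, 1)"
      by (simp add: algebra_simps)
    moreover have "?D * v $ 1 = (M $$ (q, 0) * v $ 0 + M $$ (q, 1) * v $ 1) * M $$ (p, 0)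
        - (M $$ (p, 0) * v $ 0 + M $$ (p, 1) * v $ 1) * M $$ (q, 0)"
      by (simp add: algebra_simps)
    ultimately have "?D * v $ 0 = 0" "?D * v $ 1 = 0"
      unfolding e by simp_all
    with pq(3) have "v $ 0 = 0" "v $ 1 = 0" by auto
    then have "v = 0\<^sub>v 2"
      using v(1) by (intro eq_vecI) (auto simp: less_2_cases_iff)
    with v(2) show False ..
  qed
  ultimately show "rank M = 2"
    using lin_indpt_full_rank[OF M] by blast
qed

lemma rank_submatrix_two_columns_iff:
  fixes A :: "real mat"
  assumes A: "A \<in> carrier_mat m nc" and g: "0 < g" "g < nc" and B: "B \<subseteq> {..<m}"
  shows "vec_space.rank (card B) (submatrix A B {0, g}) = 2 \<longleftrightarrow>
    (\<exists>i\<in>B. \<exists>j\<in>B. A $$ (i, 0) * A $$ (j, g) \<noteq> A $$ (j, 0) * A $$ (i, g))"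
proof -
  let ?M = "submatrix A B {0, g}"
  have rows: "{i. i < m \<and> i \<in> B} = B" using B by auto
  have cols: "{j. j < nc \<and> j \<in> {0, g}} = {0, g}" using g by auto
  have M: "?M \<in> carrier_mat (card B) 2"
  proof (rule carrier_matI)
    show "dim_row ?M = card B" unfolding dim_submatrix carrier_matD(1)[OF A] rows ..
    show "dim_col ?M = 2" unfolding dim_submatrix carrier_matD(2)[OF A] cols using g by simp
  qed
  have fin: "finite B" using B finite_subset by blast
  have pick0: "pick {0, g} 0 = 0"
    using pick_card_in_set[of 0 "{0, g}"] by simp
  have "{a \<in> {0, g}. a < g} = {0}" using g by auto
  then have pick1: "pick {0, g} 1 = g"
    using pick_card_in_set[of g "{0, g}"] by simp
  have entry: "?M $$ (p, 0) = A $$ (pick B p, 0)" "?M $$ (p, 1) = A $$ (pick B p, g)" if "p < card B" for p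
  proof -
    have p: "p < card {i. i < dim_row A \<and> i \<in> B}" using that A by (simp add: rows)
    have c: "0 < card {j. j < dim_col A \<and> j \<in> {0, g}}" "1 < card {j. j < dim_col A \<and> j \<in> {0, g}}"
      unfolding carrier_matD(2)[OF A] cols using g by simp_all
    show "?M $$ (p, 0) = A $$ (pick B p, 0)" "?M $$ (p, 1) = A $$ (pick B p, g)"
      unfolding submatrix_index[OF p c(1)] submatrix_index[OF p c(2)] pick0 pick1 by (rule refl)+
  qed
  have pick: "pick B ` {..<card B} = B"
  proof
    show "pick B ` {..<card B} \<subseteq> B" using pick_in_set_le by auto
    show "B \<subseteq> pick B ` {..<card B}"
    proof
      fix i assume i: "i \<in> B"
      have "card {a \<in> B. a < i} < card B"
        using fin i by (intro psubset_card_mono) auto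
      then have "pick B (card {a \<in> B. a < i}) \<in> pick B ` {..<card B}" by (intro imageI) simp
      then show "i \<in> pick B ` {..<card B}" unfolding pick_card_in_set[OF i] .
    qed
  qed
  have ex: "(\<exists>i\<in>B. P i) \<longleftrightarrow> (\<exists>p<card B. P (pick B p))" for P
  proof -
    have "(\<exists>i\<in>pick B ` {..<card B}. P i) \<longleftrightarrow> (\<exists>p<card B. P (pick B p))" by auto
    then show ?thesis unfolding pick .
  qed
  show ?thesis
    unfolding rank_two_columns_iff[OF M] ex by (intro ex_cong1 conj_cong refl) (simp only: entry)
qed

text \<open>
  Two disjoint independent pairs of rows suffice for a split: one pair forms the first block, and
  the second block consists of all remaining items.
\<close>

lemma split_rank_testlets_iff:
  assumes A: "A \<in> carrier_mat J (1 + G)"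
  shows "g \<in> split_rank_testlets J G t A \<longleftrightarrow> g \<in> {1..G} \<and>
    (\<exists>i\<in>testlet_items J t g. \<exists>j\<in>testlet_items J t g. \<exists>k\<in>testlet_items J t g. \<exists>m\<in>testlet_items J t g.
       {i, j} \<inter> {k, m} = {} \<and> A $$ (i, 0) * A $$ (j, g) \<noteq> A $$ (j, 0) * A $$ (i, g) \<and>
       A $$ (k, 0) * A $$ (m, g) \<noteq> A $$ (m, 0) * A $$ (k, g))" (is "_ \<longleftrightarrow> _ \<and> ?R")
proof (cases "g \<in> {1..G}")
  case True
  let ?B = "testlet_items J t g"
  let ?ind = "\<lambda>B. \<exists>i\<in>B. \<exists>j\<in>B. A $$ (i, 0) * A $$ (j, g) \<noteq> A $$ (j, 0) * A $$ (i, g)"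
  have rank: "vec_space.rank (card B) (submatrix A B {0, g}) = 2 \<longleftrightarrow> ?ind B" if "B \<subseteq> ?B" for B
    using that True by (intro rank_submatrix_two_columns_iff[OF A]) (auto simp: testlet_items_def)
  have "g \<in> split_rank_testlets J G t A \<longleftrightarrow>
      (\<exists>B1 B2. B1 \<union> B2 = ?B \<and> B1 \<inter> B2 = {} \<and> ?ind B1 \<and> ?ind B2)"
  proof -
    have "g \<in> split_rank_testlets J G t A \<longleftrightarrow> (\<exists>B1 B2. B1 \<union> B2 = ?B \<and> B1 \<inter> B2 = {} \<and>
        vec_space.rank (card B1) (submatrix A B1 {0, g}) = 2 \<and>
        vec_space.rank (card B2) (submatrix A B2 {0, g}) = 2)"
      using True by (simp add: split_rank_testlets_def)
    also have "\<dots> \<longleftrightarrow> (\<exists>B1 B2. B1 \<union> B2 = ?B \<and> B1 \<inter> B2 = {} \<and> ?ind B1 \<and> ?ind B2)"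
      by (intro ex_cong1 conj_cong refl rank) auto
    finally show ?thesis .
  qed
  also have "\<dots> \<longleftrightarrow> ?R"
  proof
    assume "\<exists>B1 B2. B1 \<union> B2 = ?B \<and> B1 \<inter> B2 = {} \<and> ?ind B1 \<and> ?ind B2"
    then obtain B1 B2 where B: "B1 \<union> B2 = ?B" "B1 \<inter> B2 = {}" and ind: "?ind B1" "?ind B2"
      by (elim exE conjE)
    from ind obtain i j k m where *: "i \<in> B1" "j \<in> B1" "k \<in> B2" "m \<in> B2"
      "A $$ (i, 0) * A $$ (j, g) \<noteq> A $$ (j, 0) * A $$ (i, g)" "A $$ (k, 0) * A $$ (m, g) \<noteq> A $$ (m, 0) * A $$ (k, g)"
      by (elim bexE)
    have "i \<in> ?B" "j \<in> ?B" "k \<in> ?B" "m \<in> ?B" "{i, j} \<inter> {k, m} = {}"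
      using *(1-4) B(2) unfolding B(1)[symmetric] by auto
    with *(5,6) show ?R
      by - (rule bexI[of _ i], rule bexI[of _ j], rule bexI[of _ k], rule bexI[of _ m], intro conjI, assumption+)
  next
    assume ?R
    then obtain i j k m where *: "i \<in> ?B" "j \<in> ?B" "k \<in> ?B" "m \<in> ?B" "{i, j} \<inter> {k, m} = {}"
      "A $$ (i, 0) * A $$ (j, g) \<noteq> A $$ (j, 0) * A $$ (i, g)" "A $$ (k, 0) * A $$ (m, g) \<noteq> A $$ (m, 0) * A $$ (k, g)"
      by (elim bexE conjE)
    then have "k \<in> ?B - {i, j}" "m \<in> ?B - {i, j}" by auto
    with *(7) have "?ind (?B - {i, j})"
      by - (rule bexI[of _ k], rule bexI[of _ m], assumption+)
    moreover have "?ind {i, j}"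
      using *(6) by - (rule bexI[of _ i], rule bexI[of _ j], assumption, simp_all)
    moreover have "{i, j} \<union> (?B - {i, j}) = ?B" "{i, j} \<inter> (?B - {i, j}) = {}" using * by auto
    ultimately show "\<exists>B1 B2. B1 \<union> B2 = ?B \<and> B1 \<inter> B2 = {} \<and> ?ind B1 \<and> ?ind B2"
      by - (rule exI[of _ "{i, j}"], rule exI[of _ "?B - {i, j}"], intro conjI)
  qed
  finally show ?thesis using True by simp
qed (auto simp: split_rank_testlets_def)

section \<open>Vectors determined up to sign by pairwise products\<close>

text \<open>
  The sign convention of the parameter space for a single column.
\<close>

definition pos_leading :: "nat \<Rightarrow> (nat \<Rightarrow> real) \<Rightarrow> bool" where
  "pos_leading J x \<longleftrightarrow> (\<forall>j<J. x j \<noteq> 0 \<and> (\<forall>i<j. x i = 0) \<longrightarrow> x j > 0)"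

lemma pos_leading_unique:
  assumes x: "pos_leading J x" and y: "pos_leading J y"
    and s: "s = 1 \<or> s = -1" and eq: "\<And>j. j < J \<Longrightarrow> y j = s * x j"
    and j: "j < J"
  shows "y j = x j"
proof (cases "\<exists>j<J. x j \<noteq> 0")
  case True
  define m where "m = (LEAST j. j < J \<and> x j \<noteq> 0)"
  have m: "m < J" "x m \<noteq> 0"
    using LeastI_ex[OF True] by (simp_all add: m_def)
  have before: "x i = 0" if "i < m" for i
    using not_less_Least[of i "\<lambda>j. j < J \<and> x j \<noteq> 0"] that m(1) by (auto simp: m_def)
  have "x m > 0" using x m before by (auto simp: pos_leading_def)
  moreover have "y m > 0"
    using y m before eq s by (auto simp: pos_leading_def)
  ultimately have "s = 1" using s eq[OF m(1)] by auto
  with eq[OF j] show ?thesis by simp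
next
  case False
  with eq[OF j] j show ?thesis by auto
qed

lemma pos_leading_sign:
  obtains s :: real where "s = 1 \<or> s = -1" "pos_leading J (\<lambda>j. s * x j)"
proof (cases "\<exists>j<J. x j \<noteq> 0")
  case True
  define m where "m = (LEAST j. j < J \<and> x j \<noteq> 0)"
  have m: "m < J" "x m \<noteq> 0"
    using LeastI_ex[OF True] by (simp_all add: m_def)
  have before: "x i = 0" if "i < m" for i
    using not_less_Least[of i "\<lambda>j. j < J \<and> x j \<noteq> 0"] that m(1) by (auto simp: m_def)
  have lead: "j = m" if "j < J" "x j \<noteq> 0" "\<forall>i<j. x i = 0" for j
    using that m before by (meson linorder_neqE_nat)
  show ?thesis
  proof (rule that[of "sgn (x m)"])
    show "sgn (x m) = 1 \<or> sgn (x m) = -1" using m(2) by (auto simp: sgn_if)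
    show "pos_leading J (\<lambda>j. sgn (x m) * x j)"
      unfolding pos_leading_def using lead m(2) by (auto simp: sgn_if)
  qed
next
  case False
  then show ?thesis by (intro that[of 1]) (auto simp: pos_leading_def)
qed

lemma square_from_products:
  fixes x y :: "'a \<Rightarrow> real"
  assumes "x i * x j = y i * y j" "x i * x k = y i * y k" "x j * x k = y j * y k"
    and "x j \<noteq> 0" "x k \<noteq> 0"
  shows "(x i)\<^sup>2 = (y i)\<^sup>2"
proof -
  have "(x i)\<^sup>2 * (x j * x k) = (x i * x j) * (x i * x k)"
    by (simp add: power2_eq_square)
  also have "\<dots> = (y i)\<^sup>2 * (y j * y k)"
    unfolding assms(1,2) by (simp add: power2_eq_square)
  finally have "(x i)\<^sup>2 * (x j * x k) = (y i)\<^sup>2 * (x j * x k)"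
    unfolding assms(3) .
  with assms(4,5) show ?thesis by simp
qed

text \<open>
  The products of \<open>x\<close> are known only for indices of different colour \<open>c\<close>. Three nonzero entries of
  different colours agree with those of \<open>y\<close> up to one common sign, and every further index differs in colour from one of two of them.
  For main loadings the colour of an item is its testlet; inside a testlet every item has its own
  colour.
\<close>

lemma proportional_by_sign:
  fixes x y :: "'a \<Rightarrow> real"
  assumes prod: "\<And>i j. i \<in> B \<Longrightarrow> j \<in> B \<Longrightarrow> c i \<noteq> c j \<Longrightarrow> x i * x j = y i * y j"
    and ijk: "i \<in> B" "j \<in> B" "k \<in> B" "c i \<noteq> c j" "c i \<noteq> c k" "c j \<noteq> c k"
    and nz: "x i \<noteq> 0" "x j \<noteq> 0" "x k \<noteq> 0"
  shows "\<exists>s. (s = 1 \<or> s = -1) \<and> (\<forall>m\<in>B. y m = s * x m)"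
proof -
  have sq: "(x i)\<^sup>2 = (y i)\<^sup>2"
    using square_from_products[of x i j y k] prod ijk nz by auto
  then obtain s where s: "s = 1 \<or> s = -1" "y i = s * x i"
    by (metis minus_mult_minus mult_1 mult_minus1 power2_eq_iff)
  have ss: "s * s = 1" using s(1) by auto
  \<comment> \<open>The sign of one nonzero entry is inherited by every entry of another colour.\<close>
  have transfer: "y m = s * x m" if "m \<in> B" "n \<in> B" "c m \<noteq> c n" "x n \<noteq> 0" "y n = s * x n" for m n
  proof -
    have "x m * x n = y m * (s * x n)" using prod[OF that(1-3)] that(5) by simp
    then have "x m = s * y m" using that(4) by simp
    then show ?thesis using ss by (metis mult.assoc mult_1)
  qed
  have "y j = s * x j" using transfer[of j i] ijk nz s(2) by auto
  then have "y m = s * x m" if "m \<in> B" for m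
    using transfer[OF that, of i] transfer[OF that, of j] ijk nz s(2) by metis
  with s(1) show ?thesis by blast
qed

text \<open>
  Cauchy-Binet for the matrix \<open>x * a * a\<^sup>T + b * b\<^sup>T\<close>: its 2-by-2 minors
  factor into determinants of pairs of rows of \<open>(a, b)\<close>.
\<close>

lemma cross_minor_identity:
  fixes x :: real
  shows "(x * (ap * ar) + bp * br) * (x * (aq * au) + bq * bu) - (x * (ap * au) + bp * bu) * (x * (aq * ar) + bq * br)
    = x * ((ap * bq - aq * bp) * (ar * bu - au * br))"
  by (simp add: algebra_simps)

lemma param_space_pos_leading:
  assumes "(A, d, l) \<in> bifactor_param_space J G t" "c \<le> G"
  shows "pos_leading J (\<lambda>j. A $$ (j, c))"
  using assms by (simp add: bifactor_param_space_def pos_leading_def)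

section \<open>Sufficiency\<close>

lemma three_elements:
  assumes "3 \<le> card S"
  obtains i j k where "i \<in> S" "j \<in> S" "k \<in> S" "i \<noteq> j" "i \<noteq> k" "j \<noteq> k"
proof -
  obtain T where "T \<subseteq> S" "card T = 3"
    using assms by (meson obtain_subset_with_card_n)
  then show thesis
    using that by (auto simp: card_3_iff)
qed

text \<open>
  Once the main loadings agree, subtracting their contribution from the covariances leaves the
  products of testlet loadings.
\<close>

lemma loadings_determined_by_main:
  assumes t: "t ` {..<J} = {1..G}"
    and \<theta>: "(A, d, l) \<in> bifactor_param_space J G t" and \<theta>': "(A', d', l') \<in> bifactor_param_space J G t"
    and cov: "\<And>i j. i < J \<Longrightarrow> j < J \<Longrightarrow> bifactor_cov t A' l' i j = bifactor_cov t A l i j"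
    and Q: "\<And>g. g \<in> {1..G} \<Longrightarrow> 3 \<le> card (testlet_support J A g)"
    and main: "\<And>j. j < J \<Longrightarrow> A' $$ (j, 0) = A $$ (j, 0)"
  shows "A' = A" "l' = l"
proof -
  have testlet: "A' $$ (j0, g) = A $$ (j0, g)" if g: "g \<in> {1..G}" and j0: "j0 < J" for g j0
  proof -
    have zero: "A $$ (j, g) = 0" "A' $$ (j, g) = 0" if "j < J" "t j \<noteq> g" for j
      using \<theta> \<theta>' that g by (auto simp: bifactor_param_space_def)
    obtain i j k where ijk: "i \<in> testlet_support J A g" "j \<in> testlet_support J A g" "k \<in> testlet_support J A g"
      and ne: "i \<noteq> j" "i \<noteq> k" "j \<noteq> k"
      using three_elements[OF Q[OF g]] by blast
    have B: "m \<in> testlet_items J t g \<and> A $$ (m, g) \<noteq> 0" if "m \<in> testlet_support J A g" for m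
      using that zero by (auto simp: testlet_support_def testlet_items_def)
    have "\<exists>s. (s = 1 \<or> s = -1) \<and> (\<forall>m\<in>testlet_items J t g. A' $$ (m, g) = s * A $$ (m, g))"
    proof (rule proportional_by_sign[where x = "\<lambda>j. A $$ (j, g)" and y = "\<lambda>j. A' $$ (j, g)"
          and c = id and i = i and j = j and k = k])
      show "A $$ (m, g) * A $$ (n, g) = A' $$ (m, g) * A' $$ (n, g)"
        if "m \<in> testlet_items J t g" "n \<in> testlet_items J t g" "id m \<noteq> id n" for m n
        using that cov[of m n] main[of m] main[of n] by (auto simp: testlet_items_def bifactor_cov_def)
    qed (use B ijk ne in auto)
    then obtain s :: real where s: "s = 1 \<or> s = -1" "\<And>m. m \<in> testlet_items J t g \<Longrightarrow> A' $$ (m, g) = s * A $$ (m, g)"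
      by blast
    have "A' $$ (m, g) = s * A $$ (m, g)" if "m < J" for m
      using s(2)[of m] zero[OF that] that by (cases "t m = g") (auto simp: testlet_items_def)
    then show ?thesis
      using pos_leading_unique[OF param_space_pos_leading[OF \<theta>] param_space_pos_leading[OF \<theta>'] s(1) _ j0, of g g] g
      by simp
  qed
  show eq: "A' = A"
  proof (rule eq_matI)
    show "A' $$ (i, j) = A $$ (i, j)" if "i < dim_row A" "j < dim_col A" for i j
      using that \<theta> main testlet by (cases "j = 0") (auto simp: bifactor_param_space_def)
  qed (use \<theta> \<theta>' in \<open>auto simp: bifactor_param_space_def\<close>)
  show "l' = l"
  proof (rule eq_vecI)
    show "l' $ i = l $ i" if "i < dim_vec l" for i
      using that \<theta> cov[of i i] eq by (auto simp: bifactor_param_space_def bifactor_cov_def)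
  qed (use \<theta> \<theta>' in \<open>auto simp: bifactor_param_space_def\<close>)
qed

lemma main_determined_by_sign:
  assumes \<theta>: "(A, d, l) \<in> bifactor_param_space J G t" and \<theta>': "(A', d', l') \<in> bifactor_param_space J G t"
    and s: "s = 1 \<or> s = -1" "\<And>m. m < J \<Longrightarrow> A' $$ (m, 0) = s * A $$ (m, 0)"
    and j: "j < J"
  shows "A' $$ (j, 0) = A $$ (j, 0)"
  using pos_leading_unique[OF param_space_pos_leading[OF \<theta>] param_space_pos_leading[OF \<theta>'] s(1) _ j, of 0 0] s(2)
  by simp

lemma main_determined_three_testlets:
  assumes \<theta>: "(A, d, l) \<in> bifactor_param_space J G t" and \<theta>': "(A', d', l') \<in> bifactor_param_space J G t"
    and cov: "\<And>i j. i < J \<Longrightarrow> j < J \<Longrightarrow> bifactor_cov t A' l' i j = bifactor_cov t A l i j"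
    and H1: "3 \<le> card (main_loaded_testlets J G t A)"
    and m: "m < J"
  shows "A' $$ (m, 0) = A $$ (m, 0)"
proof -
  obtain f g h where fgh: "f \<in> main_loaded_testlets J G t A" "g \<in> main_loaded_testlets J G t A"
      "h \<in> main_loaded_testlets J G t A" and ne: "f \<noteq> g" "f \<noteq> h" "g \<noteq> h"
    using three_elements[OF H1] by blast
  have item: "\<exists>i<J. t i = g \<and> A $$ (i, 0) \<noteq> 0" if "g \<in> main_loaded_testlets J G t A" for g
    using that by (auto simp: main_loaded_testlets_def testlet_items_def)
  obtain i j k where ijk: "i < J" "t i = f" "A $$ (i, 0) \<noteq> 0" "j < J" "t j = g" "A $$ (j, 0) \<noteq> 0"
      "k < J" "t k = h" "A $$ (k, 0) \<noteq> 0"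
    using item[OF fgh(1)] item[OF fgh(2)] item[OF fgh(3)] by blast
  have "\<exists>s. (s = 1 \<or> s = -1) \<and> (\<forall>m\<in>{..<J}. A' $$ (m, 0) = s * A $$ (m, 0))"
  proof (rule proportional_by_sign[where x = "\<lambda>j. A $$ (j, 0)" and y = "\<lambda>j. A' $$ (j, 0)"
        and c = t and i = i and j = j and k = k])
    show "A $$ (m, 0) * A $$ (n, 0) = A' $$ (m, 0) * A' $$ (n, 0)"
      if "m \<in> {..<J}" "n \<in> {..<J}" "t m \<noteq> t n" for m n
      using that cov[of m n] by (cases "m = n") (auto simp: bifactor_cov_def)
  qed (use ijk ne in auto)
  then obtain s where "s = 1 \<or> s = -1" "\<forall>m\<in>{..<J}. A' $$ (m, 0) = s * A $$ (m, 0)" by blast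
  then show ?thesis
    by (intro main_determined_by_sign[OF \<theta> \<theta>' _ _ m]) auto
qed

text \<open>
  Across testlets the main loadings are determined up to a factor \<open>c\<close> on \<open>g\<close> and \<open>1 / c\<close> on the other
  loaded testlet. The competing testlet loadings form a matrix of rank one off the diagonal, so its
  minor on two disjoint pairs of items vanishes. By \<open>cross_minor_identity\<close> this minor is \<open>1 - c\<^sup>2\<close>
  times two nonzero determinants.
\<close>

lemma main_determined_two_testlets:
  assumes \<theta>: "(A, d, l) \<in> bifactor_param_space J G t" and \<theta>': "(A', d', l') \<in> bifactor_param_space J G t"
    and cov: "\<And>i j. i < J \<Longrightarrow> j < J \<Longrightarrow> bifactor_cov t A' l' i j = bifactor_cov t A l i j"
    and H1: "card (main_loaded_testlets J G t A) = 2"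
    and H2: "g \<in> split_rank_testlets J G t A"
    and m: "m < J"
  shows "A' $$ (m, 0) = A $$ (m, 0)"
proof -
  have A: "A \<in> carrier_mat J (1 + G)" using \<theta> by (simp add: bifactor_param_space_def)
  let ?a = "\<lambda>j. A $$ (j, 0)" and ?a' = "\<lambda>j. A' $$ (j, 0)"
  let ?b = "\<lambda>j. A $$ (j, g)" and ?b' = "\<lambda>j. A' $$ (j, g)"
  have cross: "?a i * ?a j = ?a' i * ?a' j" if "i < J" "j < J" "t i \<noteq> t j" for i j
    using that cov[of i j] by (cases "i = j") (auto simp: bifactor_cov_def)
  have within: "?a i * ?a j + ?b i * ?b j = ?a' i * ?a' j + ?b' i * ?b' j"
    if "i \<in> testlet_items J t g" "j \<in> testlet_items J t g" "i \<noteq> j" for i j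
    using that cov[of i j] by (auto simp: bifactor_cov_def testlet_items_def)
  from H2[unfolded split_rank_testlets_iff[OF A]]
  obtain p q r u where p: "p \<in> testlet_items J t g" "q \<in> testlet_items J t g"
      "r \<in> testlet_items J t g" "u \<in> testlet_items J t g" and ne: "{p, q} \<inter> {r, u} = {}"
      and det: "?a p * ?b q \<noteq> ?a q * ?b p" "?a r * ?b u \<noteq> ?a u * ?b r" and g: "g \<in> {1..G}"
    by (elim conjE bexE)
  have "\<exists>i\<in>testlet_items J t g. ?a i \<noteq> 0"
    using det(1) p(1,2) by (cases "?a p = 0") auto
  then have gH: "g \<in> main_loaded_testlets J G t A"
    using g by (auto simp: main_loaded_testlets_def)
  then obtain i where i: "i < J" "t i = g" "?a i \<noteq> 0"
    by (auto simp: main_loaded_testlets_def testlet_items_def)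
  obtain h where h: "h \<in> main_loaded_testlets J G t A" "h \<noteq> g"
    using H1 gH by (metis card_2_iff insertI1 insertI2)
  then obtain j where j: "j < J" "t j = h" "?a j \<noteq> 0"
    by (auto simp: main_loaded_testlets_def testlet_items_def)
  have ij: "?a i * ?a j = ?a' i * ?a' j"
    using cross i j h by auto
  with i j have nz': "?a' i \<noteq> 0" "?a' j \<noteq> 0" by auto
  define c where "c = ?a' i / ?a i"
  have c: "c \<noteq> 0" "?a' i = c * ?a i" "?a j = c * ?a' j"
    using i j nz' ij by (auto simp: c_def field_simps)
  have in_g: "?a' n = c * ?a n" if "n < J" "t n = g" for n
    using cross[OF that(1) j(1)] that j h c nz' by (simp add: mult.commute)
  have out_g: "?a n = c * ?a' n" if "n < J" "t n \<noteq> g" for n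
    using cross[OF that(1) i(1)] that i c by simp
  have "(1 - c * c) * ((?a p * ?b q - ?a q * ?b p) * (?a r * ?b u - ?a u * ?b r)) = 0"
  proof -
    have bb: "?b' n * ?b' n' = (1 - c * c) * (?a n * ?a n') + ?b n * ?b n'"
      if "n \<in> testlet_items J t g" "n' \<in> testlet_items J t g" "n \<noteq> n'" for n n'
      using within[OF that] in_g[of n] in_g[of n'] that by (simp add: testlet_items_def algebra_simps)
    have "(?b' p * ?b' r) * (?b' q * ?b' u) = (?b' p * ?b' u) * (?b' q * ?b' r)"
      by simp
    moreover have "?b' p * ?b' r = (1 - c * c) * (?a p * ?a r) + ?b p * ?b r"
      "?b' q * ?b' u = (1 - c * c) * (?a q * ?a u) + ?b q * ?b u"
      "?b' p * ?b' u = (1 - c * c) * (?a p * ?a u) + ?b p * ?b u"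
      "?b' q * ?b' r = (1 - c * c) * (?a q * ?a r) + ?b q * ?b r"
      using bb p ne by auto
    ultimately show ?thesis
      unfolding cross_minor_identity[symmetric] by simp
  qed
  with det have "c * c = 1" by simp
  then have s: "c = 1 \<or> c = -1" using square_eq_1_iff by blast
  have "?a' n = c * ?a n" if "n < J" for n
    using in_g[OF that] out_g[OF that] s by (cases "t n = g") auto
  then show ?thesis
    by (intro main_determined_by_sign[OF \<theta> \<theta>' s _ m]) auto
qed

theorem bifactor_identifiable_if:
  assumes t: "t ` {..<J} = {1..G}" and \<theta>: "(A, d, l) \<in> bifactor_param_space J G t"
    and Q: "\<And>g. g \<in> {1..G} \<Longrightarrow> 3 \<le> card (testlet_support J A g)"
    and H: "3 \<le> card (main_loaded_testlets J G t A) \<or>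
      card (main_loaded_testlets J G t A) = 2 \<and> split_rank_testlets J G t A \<noteq> {}"
  shows "bifactor_identifiable_at J G t (A, d, l)"
  unfolding bifactor_identifiable_at_def
proof (intro ballI impI)
  fix \<theta>' assume "\<theta>' \<in> bifactor_param_space J G t" "bifactor_law J G t \<theta>' = bifactor_law J G t (A, d, l)"
  moreover obtain A' d' l' where "\<theta>' = (A', d', l')" by (metis surj_pair)
  ultimately have \<theta>': "(A', d', l') \<in> bifactor_param_space J G t" and d: "d' = d"
    and cov: "\<And>i j. i < J \<Longrightarrow> j < J \<Longrightarrow> bifactor_cov t A' l' i j = bifactor_cov t A l i j"
    and eq: "\<theta>' = (A', d', l')"
    using bifactor_law_eq_iff[OF t \<theta>] by auto
  have main: "A' $$ (j, 0) = A $$ (j, 0)" if "j < J" for j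
    using H main_determined_three_testlets[OF \<theta> \<theta>' cov _ that]
      main_determined_two_testlets[OF \<theta> \<theta>' cov _ _ that] by blast
  show "\<theta>' = (A, d, l)"
    using loadings_determined_by_main[OF t \<theta> \<theta>' cov Q main] d eq by simp
qed

section \<open>A criterion for non-identifiability\<close>

text \<open>
  Flipping the sign of a whole column changes no covariance, so competing loadings need not obey the
  sign convention; they only have to differ from the given ones in absolute value. The strict
  inequality on the diagonal is what keeps the new unique variances positive.
\<close>

lemma not_identifiableI:
  assumes t: "t ` {..<J} = {1..G}" and \<theta>: "(A, d, l) \<in> bifactor_param_space J G t"
    and off: "\<And>i j. i < J \<Longrightarrow> j < J \<Longrightarrow> i \<noteq> j \<Longrightarrow>
      a i * a j + (if t i = t j then b i * b j else 0)
      = A $$ (i, 0) * A $$ (j, 0) + (if t i = t j then A $$ (i, t i) * A $$ (j, t j) else 0)"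
    and diag: "\<And>j. j < J \<Longrightarrow> (a j)\<^sup>2 + (b j)\<^sup>2 < (A $$ (j, 0))\<^sup>2 + (A $$ (j, t j))\<^sup>2 + l $ j"
    and ne: "j0 < J" "\<bar>a j0\<bar> \<noteq> \<bar>A $$ (j0, 0)\<bar> \<or> \<bar>b j0\<bar> \<noteq> \<bar>A $$ (j0, t j0)\<bar>"
  shows "\<not> bifactor_identifiable_at J G t (A, d, l)"
proof
  assume ident: "bifactor_identifiable_at J G t (A, d, l)"
  have tj: "t j \<in> {1..G}" if "j < J" for j using t that by blast
  \<comment> \<open>Column \<open>c\<close> of the competing loading matrix, before its sign is normalised.\<close>
  define x where "x c j = (if c = 0 then a j else if c = t j then b j else 0)" for c j
  have "\<exists>s::real. (s = 1 \<or> s = -1) \<and> pos_leading J (\<lambda>j. s * x c j)" for c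
    by (rule pos_leading_sign[of J "x c"]) blast
  then obtain s :: "nat \<Rightarrow> real" where s: "\<And>c. s c = 1 \<or> s c = -1" "\<And>c. pos_leading J (\<lambda>j. s c * x c j)"
    by metis
  have ss: "s c * s c = 1" "\<bar>s c\<bar> = 1" for c using s(1)[of c] by auto
  define A' where "A' = mat J (1 + G) (\<lambda>(j, c). s c * x c j)"
  define l' where "l' = vec J (\<lambda>j. (A $$ (j, 0))\<^sup>2 + (A $$ (j, t j))\<^sup>2 + l $ j - (a j)\<^sup>2 - (b j)\<^sup>2)"
  have A': "A' $$ (j, c) = s c * x c j" if "j < J" "c \<le> G" for j c
    using that by (simp add: A'_def)
  have A'0: "A' $$ (j, 0) = s 0 * a j" if "j < J" for j
    using that by (simp add: A' x_def)
  have A't: "A' $$ (j, t j) = s (t j) * b j" if "j < J" for j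
    using tj[OF that] that by (simp add: A' x_def)
  have \<theta>': "(A', d, l') \<in> bifactor_param_space J G t"
    unfolding bifactor_param_space_def mem_Collect_eq prod.case
  proof (intro conjI allI impI ballI)
    show "A' \<in> carrier_mat J (1 + G)" "l' \<in> carrier_vec J" by (simp_all add: A'_def l'_def)
    show "d \<in> carrier_vec J" using \<theta> by (simp add: bifactor_param_space_def)
    show "A' $$ (j, g) = 0" if "j < J" "g \<in> {1..G}" "g \<noteq> t j" for j g
      using that by (simp add: A' x_def)
    show "0 < l' $ j" if "j < J" for j
      using diag[OF that] that by (simp add: l'_def)
    show "0 < A' $$ (j, c)" if "c \<le> G" "j < J" "A' $$ (j, c) \<noteq> 0 \<and> (\<forall>i<j. A' $$ (i, c) = 0)" for j c
    proof -
      have "\<forall>i<j. s c * x c i = 0" using that A'[of _ c] by auto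
      then show ?thesis
        using s(2)[of c, unfolded pos_leading_def] that A'[of j c] by auto
    qed
  qed
  have "bifactor_cov t A' l' i j = bifactor_cov t A l i j" if "i < J" "j < J" for i j
  proof -
    have prod: "s c * y * (s c * z) = y * z" for c y z
    proof -
      have "s c * y * (s c * z) = (s c * s c) * (y * z)" by (simp only: mult_ac)
      then show ?thesis unfolding ss by simp
    qed
    have main: "A' $$ (i, 0) * A' $$ (j, 0) = a i * a j"
      using that by (simp only: A'0 prod)
    have testlet: "A' $$ (i, t i) * A' $$ (j, t j) = b i * b j" if "t i = t j"
      using A't[OF \<open>i < J\<close>] A't[OF \<open>j < J\<close>] that prod by simp
    show ?thesis
    proof (cases "i = j")
      case True
      then show ?thesis
        using that main testlet by (simp add: bifactor_cov_def l'_def power2_eq_square)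
    next
      case False
      then show ?thesis
        using off[OF that False] main testlet by (simp add: bifactor_cov_def split: if_splits)
    qed
  qed
  then have "bifactor_law J G t (A', d, l') = bifactor_law J G t (A, d, l)"
    using bifactor_law_eq_iff[OF t \<theta> \<theta>'] by blast
  with ident \<theta>' have "A' = A"
    unfolding bifactor_identifiable_at_def by blast
  then have "\<bar>A $$ (j0, 0)\<bar> = \<bar>a j0\<bar>" "\<bar>A $$ (j0, t j0)\<bar> = \<bar>b j0\<bar>"
    using A'0[OF ne(1)] A't[OF ne(1)] ss(2) by (auto simp: abs_mult)
  with ne(2) show False by simp
qed

section \<open>Rescaling the main loadings of one testlet\<close>

text \<open>
  Consider the rows \<open>(a j, b j)\<close> as vectors in the plane. If all pairs are dependent, all rows lie on
  one line. Otherwise fix an independent pair \<open>i, j\<close>; then all other rows are pairwise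
  dependent. If two of them, \<open>u\<close> and \<open>v\<close>, are nonzero, they span a common line; the pairs \<open>i, u\<close> and \<open>j, v\<close> are disjoint, so one of \<open>i\<close> and \<open>j\<close> lies on that line as well, and only the
  other one may lie outside. If at most one further row is nonzero, at most three rows are nonzero.
  The line is not \<open>b = 0\<close>, because at least two of the rows on it have a nonzero second entry.
\<close>

lemma no_disjoint_independent_pairs_cases:
  fixes a b :: "'a \<Rightarrow> real"
  assumes dep: "\<And>i j k m. i \<in> B \<Longrightarrow> j \<in> B \<Longrightarrow> k \<in> B \<Longrightarrow> m \<in> B \<Longrightarrow> {i, j} \<inter> {k, m} = {} \<Longrightarrow>
      a i * b j = a j * b i \<or> a k * b m = a m * b k"
    and three: "3 \<le> card {j \<in> B. b j \<noteq> 0}"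
  shows "(\<exists>i0 k. \<forall>j\<in>B - {i0}. a j = k * b j) \<or>
    (\<exists>p\<in>B. \<exists>q\<in>B. \<exists>r\<in>B. p \<noteq> q \<and> p \<noteq> r \<and> q \<noteq> r \<and> b p \<noteq> 0 \<and> b q \<noteq> 0 \<and> b r \<noteq> 0 \<and>
      (\<forall>j\<in>B - {p, q, r}. a j = 0 \<and> b j = 0))" (is "?line \<or> ?three")
proof -
  define D where "D x y \<longleftrightarrow> a x * b y = a y * b x" for x y
  have D_sym: "D x y \<Longrightarrow> D y x" for x y by (simp add: D_def)
  have dep: "D i j \<or> D k m" if "i \<in> B" "j \<in> B" "k \<in> B" "m \<in> B" "{i, j} \<inter> {k, m} = {}" for i j k m
    using dep[OF that] by (simp add: D_def)
  have line: ?line if u: "u \<in> B" "a u \<noteq> 0 \<or> b u \<noteq> 0" and D: "\<And>x. x \<in> B \<Longrightarrow> x \<noteq> j \<Longrightarrow> D x u" for u j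
  proof -
    have "\<not> {j \<in> B. b j \<noteq> 0} \<subseteq> {j}"
      using three card_mono[of "{j}" "{j \<in> B. b j \<noteq> 0}"] by auto
    \<comment> \<open>A vertical line, with \<open>b u = 0\<close>, would force \<open>b w = 0\<close>.\<close>
    then obtain w where "w \<in> B" "b w \<noteq> 0" "w \<noteq> j" by blast
    with D[of w] u have "b u \<noteq> 0" by (auto simp: D_def)
    then have "a x = a u / b u * b x" if "x \<in> B" "x \<noteq> j" for x
      using D[OF that] by (simp add: D_def field_simps)
    then have "\<forall>x\<in>B - {j}. a x = a u / b u * b x" by blast
    then show ?line by blast
  qed
  show ?thesis
  proof (cases "\<forall>i\<in>B. \<forall>j\<in>B. D i j")
    case True
    have "{j \<in> B. b j \<noteq> 0} \<noteq> {}"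
    proof
      assume "{j \<in> B. b j \<noteq> 0} = {}"
      with three have "(3::nat) \<le> card ({} :: 'a set)" by (simp only:)
      then show False by simp
    qed
    then obtain u where "u \<in> B" "b u \<noteq> 0" by blast
    with True line[of u u] show ?thesis by blast
  next
    case False
    then obtain i j where ij: "i \<in> B" "j \<in> B" "\<not> D i j" by blast
    have rest: "D x y" if "x \<in> B - {i, j}" "y \<in> B - {i, j}" for x y
      using dep[of i j x y] ij that by auto
    define N where "N = {x \<in> B - {i, j}. a x \<noteq> 0 \<or> b x \<noteq> 0}"
    show ?thesis
    proof (cases "\<exists>u\<in>N. \<exists>v\<in>N. u \<noteq> v")
      case True
      then obtain u v where uv: "u \<in> N" "v \<in> N" "u \<noteq> v" by blast
      have "i \<noteq> j" using ij(3) by (auto simp: D_def)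
      with uv ij have "D i u \<or> D j v"
        by (intro dep) (auto simp: N_def)
      then show ?thesis
      proof
        assume "D i u"
        then have "D x u" if "x \<in> B" "x \<noteq> j" for x
          using rest[of x u] that uv by (cases "x = i") (auto simp: N_def)
        with line[of u j] uv(1) show ?thesis by (auto simp: N_def)
      next
        assume "D j v"
        then have "D x v" if "x \<in> B" "x \<noteq> i" for x
          using rest[of x v] that uv by (cases "x = j") (auto simp: N_def)
        with line[of v i] uv(2) show ?thesis by (auto simp: N_def)
      qed
    next
      case False
      obtain w where w: "N \<subseteq> {w}"
      proof (cases "N = {}")
        case False
        then obtain w where "w \<in> N" by blast
        with \<open>\<not> (\<exists>u\<in>N. \<exists>v\<in>N. u \<noteq> v)\<close> have "N \<subseteq> {w}" by blast
        then show thesis by (rule that)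
      qed (use that in blast)
      have sub: "{j \<in> B. b j \<noteq> 0} \<subseteq> {i, j, w}"
        using w by (auto simp: N_def)
      moreover have "card {i, j, w} \<le> 3" by (simp add: card_insert_if)
      ultimately have eq: "{j \<in> B. b j \<noteq> 0} = {i, j, w}"
        using three by (intro card_seteq) auto
      then have "card {i, j, w} = 3"
        using three \<open>card {i, j, w} \<le> 3\<close> by simp
      then have "i \<noteq> j" "i \<noteq> w" "j \<noteq> w"
        by (auto simp: card_insert_if split: if_splits)
      moreover have "i \<in> {j \<in> B. b j \<noteq> 0}" "j \<in> {j \<in> B. b j \<noteq> 0}" "w \<in> {j \<in> B. b j \<noteq> 0}"
        unfolding eq by simp_all
      moreover have "\<forall>x\<in>B - {i, j, w}. a x = 0 \<and> b x = 0"
        using w by (auto simp: N_def)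
      ultimately have ?three
        by (intro bexI[of _ i] bexI[of _ j] bexI[of _ w]) auto
      then show ?thesis ..
    qed
  qed
qed

text \<open>
  On the line the covariances are \<open>(1 + k\<^sup>2) * b i * b j\<close>, so rescaling the \<open>a\<close>-part by \<open>c\<close> is
  compensated by rescaling the \<open>b\<close>-part by \<open>m c\<close>, where \<open>c\<^sup>2 * k\<^sup>2 + (m c)\<^sup>2 = 1 + k\<^sup>2\<close>. The covariances of
  the exceptional item \<open>i0\<close> with the others all lead to the same equation for its new loading.
\<close>

lemma line_adjustment:
  fixes a b :: "'a \<Rightarrow> real"
  assumes line: "\<And>j. j \<in> B \<Longrightarrow> j \<noteq> i0 \<Longrightarrow> a j = k * b j"
  shows "\<exists>\<beta>. (\<forall>j. ((\<lambda>c. \<beta> c j) \<longlongrightarrow> b j) (nhds 1)) \<and>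
    (\<forall>\<^sub>F c in nhds 1. \<forall>i\<in>B. \<forall>j\<in>B. i \<noteq> j \<longrightarrow> c\<^sup>2 * (a i * a j) + \<beta> c i * \<beta> c j = a i * a j + b i * b j)"
proof -
  define m where "m c = sqrt (1 + k\<^sup>2 * (1 - c\<^sup>2))" for c
  define \<beta> where "\<beta> c j = (if j = i0 then (b i0 + (1 - c\<^sup>2) * k * a i0) / m c else m c * b j)" for c j
  have lim: "((\<lambda>c. 1 + k\<^sup>2 * (1 - c\<^sup>2)) \<longlongrightarrow> 1) (nhds 1)"
    by (auto intro!: tendsto_eq_intros filterlim_ident)
  then have m: "(m \<longlongrightarrow> 1) (nhds 1)"
    unfolding m_def using tendsto_real_sqrt[OF lim] by simp
  have "((\<lambda>c. \<beta> c j) \<longlongrightarrow> b j) (nhds 1)" for j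
    unfolding \<beta>_def by (cases "j = i0") (auto intro!: tendsto_eq_intros filterlim_ident m)
  moreover have "\<forall>\<^sub>F c in nhds 1. \<forall>i\<in>B. \<forall>j\<in>B. i \<noteq> j \<longrightarrow>
      c\<^sup>2 * (a i * a j) + \<beta> c i * \<beta> c j = a i * a j + b i * b j"
  proof (rule eventually_mono[OF order_tendstoD(1)[OF lim, of 0]], simp, intro ballI impI)
    fix c i j assume pos: "0 < 1 + k\<^sup>2 * (1 - c\<^sup>2)" and ij: "i \<in> B" "j \<in> B" "i \<noteq> j"
    have mm: "m c * m c = 1 + k\<^sup>2 * (1 - c\<^sup>2)" and m0: "m c \<noteq> 0"
      using pos by (auto simp: m_def)
    have one: "c\<^sup>2 * (a i0 * a j) + \<beta> c i0 * \<beta> c j = a i0 * a j + b i0 * b j" if "j \<in> B" "j \<noteq> i0" for j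
    proof -
      have "\<beta> c i0 * \<beta> c j = (b i0 + (1 - c\<^sup>2) * k * a i0) * b j" using m0 that by (simp add: \<beta>_def)
      then show ?thesis unfolding line[OF that] by (simp add: algebra_simps)
    qed
    show "c\<^sup>2 * (a i * a j) + \<beta> c i * \<beta> c j = a i * a j + b i * b j"
    proof (cases "i = i0 \<or> j = i0")
      case True
      then show ?thesis using one[of i] one[of j] ij by (auto simp: mult.commute)
    next
      case False
      then have "a i = k * b i" "a j = k * b j" using line ij by auto
      moreover have "\<beta> c i * \<beta> c j = (m c * m c) * (b i * b j)" using False by (simp add: \<beta>_def)
      ultimately show ?thesis unfolding mm by (simp add: algebra_simps power2_eq_square)
    qed
  qed
  ultimately show ?thesis by blast
qed

text \<open>
  With three items there are three prescribed products and three unknowns. The function \<open>u\<close> gives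
  the required products relative to the original ones; near \<open>c = 1\<close> they are positive, and then
  \<open>x * y\<close>, \<open>x * z\<close>, \<open>y * z\<close> can be solved for \<open>x\<close>, \<open>y\<close>, \<open>z\<close> by square roots.
\<close>

lemma three_rows_adjustment:
  fixes a b :: "'a \<Rightarrow> real"
  assumes ne: "p \<noteq> q" "p \<noteq> r" "q \<noteq> r" and nz: "b p \<noteq> 0" "b q \<noteq> 0" "b r \<noteq> 0"
    and zero: "\<And>j. j \<in> B \<Longrightarrow> j \<notin> {p, q, r} \<Longrightarrow> a j = 0 \<and> b j = 0"
  shows "\<exists>\<beta>. (\<forall>j. ((\<lambda>c. \<beta> c j) \<longlongrightarrow> b j) (nhds 1)) \<and>
    (\<forall>\<^sub>F c in nhds 1. \<forall>i\<in>B. \<forall>j\<in>B. i \<noteq> j \<longrightarrow> c\<^sup>2 * (a i * a j) + \<beta> c i * \<beta> c j = a i * a j + b i * b j)"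
proof -
  define u where "u i j c = 1 + (1 - c\<^sup>2) * ((a i / b i) * (a j / b j))" for i j and c :: real
  define \<beta> where "\<beta> c j = b j * sqrt (if j = p then u p q c * u p r c / u q r c
      else if j = q then u p q c * u q r c / u p r c
      else if j = r then u p r c * u q r c / u p q c else 1)" for c j
  have "((\<lambda>c. 1 + (1 - c\<^sup>2) * x) \<longlongrightarrow> 1) (nhds 1)" for x :: real
    by (auto intro!: tendsto_eq_intros filterlim_ident)
  then have u: "(u i j \<longlongrightarrow> 1) (nhds 1)" for i j
    unfolding u_def .
  have "((\<lambda>c. \<beta> c j) \<longlongrightarrow> b j) (nhds 1)" for j
  proof -
    have "((\<lambda>c. u i j c * u k l c / u m n c) \<longlongrightarrow> 1) (nhds 1)" for i j k l m n
      using tendsto_divide[OF tendsto_mult[OF u[of i j] u[of k l]] u[of m n]] by simp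
    from tendsto_mult[OF tendsto_const[of "b j"] tendsto_real_sqrt[OF this]]
    have l: "((\<lambda>c. b j * sqrt (u i' j' c * u k l c / u m n c)) \<longlongrightarrow> b j) (nhds 1)" for i' j' k l m n
      by simp
    show ?thesis
      unfolding \<beta>_def using l[of p q p r q r] l[of p q q r p r] l[of p r q r p q]
      by (cases "j = p"; cases "j = q"; cases "j = r") simp_all
  qed
  moreover have "\<forall>\<^sub>F c in nhds 1. \<forall>i\<in>B. \<forall>j\<in>B. i \<noteq> j \<longrightarrow>
      c\<^sup>2 * (a i * a j) + \<beta> c i * \<beta> c j = a i * a j + b i * b j"
  proof -
    have "\<forall>\<^sub>F c in nhds 1. 0 < u i j c" for i j
      using order_tendstoD(1)[OF u[of i j], of 0] by simp
    from this[of p q] this[of p r] this[of q r] show ?thesis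
    proof eventually_elim
      case (elim c)
      have cancel: "sqrt (x * y / z) * sqrt (x * z / y) = x" "sqrt (x * y / z) * sqrt (y * z / x) = y"
        "sqrt (x * z / y) * sqrt (y * z / x) = z" if "0 < x" "0 < y" "0 < z" for x y z :: real
        using that by (simp_all add: field_simps flip: real_sqrt_mult)
      have \<beta>: "\<beta> c p = b p * sqrt (u p q c * u p r c / u q r c)" "\<beta> c q = b q * sqrt (u p q c * u q r c / u p r c)"
        "\<beta> c r = b r * sqrt (u p r c * u q r c / u p q c)"
        using ne by (simp_all add: \<beta>_def)
      have group: "(x * y) * (z * w) = (x * z) * (y * w)" for x y z w :: real by simp
      have prod: "\<beta> c p * \<beta> c q = b p * b q * u p q c" "\<beta> c p * \<beta> c r = b p * b r * u p r c"
        "\<beta> c q * \<beta> c r = b q * b r * u q r c"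
        unfolding \<beta> group using cancel[OF elim] by simp_all
      have pair: "c\<^sup>2 * (a i * a j) + b i * b j * u i j c = a i * a j + b i * b j" if "b i \<noteq> 0" "b j \<noteq> 0" for i j
      proof -
        have "b i * b j * u i j c = b i * b j + (1 - c\<^sup>2) * ((b i * (a i / b i)) * (b j * (a j / b j)))"
          by (simp add: u_def distrib_left)
        also have "\<dots> = b i * b j + (1 - c\<^sup>2) * (a i * a j)" using that by simp
        finally show ?thesis by (simp add: left_diff_distrib)
      qed
      have main: "c\<^sup>2 * (a i * a j) + \<beta> c i * \<beta> c j = a i * a j + b i * b j"
        if "(i, j) \<in> {(p, q), (p, r), (q, r), (q, p), (r, p), (r, q)}" for i j
        using that pair[OF nz(1,2)] pair[OF nz(1,3)] pair[OF nz(2,3)] prod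
        by (auto simp: mult.commute)
      show ?case
      proof (intro ballI impI)
        fix i j assume ij: "i \<in> B" "j \<in> B" "i \<noteq> j"
        show "c\<^sup>2 * (a i * a j) + \<beta> c i * \<beta> c j = a i * a j + b i * b j"
        proof (cases "i \<in> {p, q, r} \<and> j \<in> {p, q, r}")
          case True
          with ij(3) show ?thesis by (intro main) auto
        next
          case False
          then have "a i = 0 \<and> b i = 0 \<or> a j = 0 \<and> b j = 0" using zero ij by blast
          then show ?thesis by (auto simp: \<beta>_def)
        qed
      qed
    qed
  qed
  ultimately show ?thesis by blast
qed

text \<open>
  As the adjusted loadings tend to the original ones for \<open>c \<longlongrightarrow> 1\<close>, the room left by the positive
  unique variances is enough for \<open>c\<close> close to 1.
\<close>

lemma adjustable_if_no_disjoint_independent_pairs: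
  fixes a b l :: "'a \<Rightarrow> real"
  assumes fin: "finite B" and l: "\<And>j. j \<in> B \<Longrightarrow> 0 < l j"
    and dep: "\<And>i j k m. i \<in> B \<Longrightarrow> j \<in> B \<Longrightarrow> k \<in> B \<Longrightarrow> m \<in> B \<Longrightarrow> {i, j} \<inter> {k, m} = {} \<Longrightarrow>
      a i * b j = a j * b i \<or> a k * b m = a m * b k"
    and three: "3 \<le> card {j \<in> B. b j \<noteq> 0}"
  shows "\<forall>\<^sub>F c in nhds 1. \<exists>b'. (\<forall>i\<in>B. \<forall>j\<in>B. i \<noteq> j \<longrightarrow> c\<^sup>2 * (a i * a j) + b' i * b' j = a i * a j + b i * b j) \<and>
    (\<forall>j\<in>B. c\<^sup>2 * (a j)\<^sup>2 + (b' j)\<^sup>2 < (a j)\<^sup>2 + (b j)\<^sup>2 + l j)"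
proof -
  have "\<exists>\<beta>. (\<forall>j. ((\<lambda>c. \<beta> c j) \<longlongrightarrow> b j) (nhds 1)) \<and>
    (\<forall>\<^sub>F c in nhds 1. \<forall>i\<in>B. \<forall>j\<in>B. i \<noteq> j \<longrightarrow> c\<^sup>2 * (a i * a j) + \<beta> c i * \<beta> c j = a i * a j + b i * b j)"
  proof -
    have "(\<exists>i0 k. \<forall>j\<in>B - {i0}. a j = k * b j) \<or>
      (\<exists>p\<in>B. \<exists>q\<in>B. \<exists>r\<in>B. p \<noteq> q \<and> p \<noteq> r \<and> q \<noteq> r \<and> b p \<noteq> 0 \<and> b q \<noteq> 0 \<and> b r \<noteq> 0 \<and>
        (\<forall>j\<in>B - {p, q, r}. a j = 0 \<and> b j = 0))"
      by (rule no_disjoint_independent_pairs_cases) (fact dep three)+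
    then show ?thesis
    proof (elim disjE exE bexE conjE)
      fix i0 k assume "\<forall>j\<in>B - {i0}. a j = k * b j"
      then show ?thesis by (intro line_adjustment[of B i0 a k b]) auto
    next
      fix p q r assume "p \<noteq> q" "p \<noteq> r" "q \<noteq> r" "b p \<noteq> 0" "b q \<noteq> 0" "b r \<noteq> 0"
        "\<forall>j\<in>B - {p, q, r}. a j = 0 \<and> b j = 0"
      then show ?thesis by (intro three_rows_adjustment[of p q r b B a]) auto
    qed
  qed
  then obtain \<beta> where lim: "\<And>j. ((\<lambda>c. \<beta> c j) \<longlongrightarrow> b j) (nhds 1)"
    and off: "\<forall>\<^sub>F c in nhds 1. \<forall>i\<in>B. \<forall>j\<in>B. i \<noteq> j \<longrightarrow> c\<^sup>2 * (a i * a j) + \<beta> c i * \<beta> c j = a i * a j + b i * b j"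
    by blast
  have "\<forall>\<^sub>F c in nhds 1. \<forall>j\<in>B. c\<^sup>2 * (a j)\<^sup>2 + (\<beta> c j)\<^sup>2 < (a j)\<^sup>2 + (b j)\<^sup>2 + l j"
  proof (intro eventually_ball_finite fin ballI)
    fix j assume "j \<in> B"
    have "((\<lambda>c. c\<^sup>2 * (a j)\<^sup>2 + (\<beta> c j)\<^sup>2) \<longlongrightarrow> (a j)\<^sup>2 + (b j)\<^sup>2) (nhds 1)"
      by (auto intro!: tendsto_eq_intros filterlim_ident lim)
    from order_tendstoD(2)[OF this, of "(a j)\<^sup>2 + (b j)\<^sup>2 + l j"] l[OF \<open>j \<in> B\<close>]
    show "\<forall>\<^sub>F c in nhds 1. c\<^sup>2 * (a j)\<^sup>2 + (\<beta> c j)\<^sup>2 < (a j)\<^sup>2 + (b j)\<^sup>2 + l j" by simp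
  qed
  with off show ?thesis by eventually_elim blast
qed

section \<open>Necessity\<close>

lemma card_less_3_cases:
  assumes "finite S" "card S < 3"
  obtains "S = {}" | i where "S = {i}" | i j where "S = {i, j}" "i \<noteq> j"
proof -
  have "card S = 0 \<or> card S = 1 \<or> card S = 2" using assms(2) by auto
  with assms(1) that show thesis
    by (auto simp: card_1_singleton_iff card_2_iff)
qed

text \<open>
  A single nonzero testlet loading (or a zero one, if there is none) occurs only in the variance of
  its item, so it can be enlarged at the cost of the unique variance. Two loadings occur otherwise
  only through their product, so one can be scaled by \<open>c > 1\<close> and the other by \<open>1 / c\<close>.
\<close>

lemma sparse_testlet_not_identifiable:
  assumes t: "t ` {..<J} = {1..G}" and \<theta>: "(A, d, l) \<in> bifactor_param_space J G t"
    and g: "g \<in> {1..G}" and Q: "card (testlet_support J A g) < 3"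
  shows "\<not> bifactor_identifiable_at J G t (A, d, l)"
proof -
  have l: "0 < l $ j" if "j < J" for j using param_space_variance_pos[OF \<theta> that] .
  have Q_iff: "j \<in> testlet_support J A g \<longleftrightarrow> j < J \<and> t j = g \<and> A $$ (j, t j) \<noteq> 0" for j
    using param_space_zero[OF \<theta> _ g] by (auto simp: testlet_support_def)
  have single: ?thesis
    if j0: "j0 < J" "t j0 = g" and others: "\<And>j. j < J \<Longrightarrow> t j = g \<Longrightarrow> j \<noteq> j0 \<Longrightarrow> A $$ (j, t j) = 0" for j0
  proof -
    \<comment> \<open>This moves half of the unique variance of \<open>j0\<close> into its testlet loading.\<close>
    define x where "x = sqrt ((A $$ (j0, g))\<^sup>2 + l $ j0 / 2)"
    have x: "x\<^sup>2 = (A $$ (j0, g))\<^sup>2 + l $ j0 / 2"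
      using l[OF j0(1)] by (simp add: x_def)
    show ?thesis
    proof (rule not_identifiableI[OF t \<theta>, where a = "\<lambda>j. A $$ (j, 0)"
          and b = "\<lambda>j. if j = j0 then x else A $$ (j, t j)" and ?j0.0 = j0])
      show "A $$ (i, 0) * A $$ (j, 0) + (if t i = t j
          then (if i = j0 then x else A $$ (i, t i)) * (if j = j0 then x else A $$ (j, t j)) else 0)
        = A $$ (i, 0) * A $$ (j, 0) + (if t i = t j then A $$ (i, t i) * A $$ (j, t j) else 0)"
        if "i < J" "j < J" "i \<noteq> j" for i j
        using others[of i] others[of j] that j0 by (cases "i = j0"; cases "j = j0") auto
      show "(A $$ (j, 0))\<^sup>2 + (if j = j0 then x else A $$ (j, t j))\<^sup>2 < (A $$ (j, 0))\<^sup>2 + (A $$ (j, t j))\<^sup>2 + l $ j"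
        if "j < J" for j
        using l[OF that] x j0 by auto
      have "\<bar>x\<bar> \<noteq> \<bar>A $$ (j0, t j0)\<bar>"
        using x l[OF j0(1)] j0(2) by (auto dest: abs_eq_iff[THEN iffD1] simp: power2_eq_iff)
      then show "\<bar>A $$ (j0, 0)\<bar> \<noteq> \<bar>A $$ (j0, 0)\<bar> \<or> \<bar>if j0 = j0 then x else A $$ (j0, t j0)\<bar> \<noteq> \<bar>A $$ (j0, t j0)\<bar>"
        by simp
    qed (fact j0)
  qed
  have fin: "finite (testlet_support J A g)" by (simp add: testlet_support_def)
  show ?thesis
  proof (cases rule: card_less_3_cases[OF fin Q])
    case 1
    have "g \<in> t ` {..<J}" using t g by simp
    then obtain j0 where "j0 < J" "t j0 = g" by auto
    with 1 Q_iff show ?thesis by (intro single[of j0]) auto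
  next
    case (2 j0)
    then have "j0 < J" "t j0 = g" using Q_iff by auto
    with 2 Q_iff show ?thesis by (intro single[of j0]) auto
  next
    case (3 p q)
    then have "p \<in> testlet_support J A g" "q \<in> testlet_support J A g" by simp_all
    then have p: "p < J" "t p = g" "A $$ (p, g) \<noteq> 0" and q: "q < J" "t q = g" "A $$ (q, g) \<noteq> 0"
      using Q_iff[of p] Q_iff[of q] by auto
    have others: "A $$ (j, t j) = 0" if "j < J" "t j = g" "j \<noteq> p" "j \<noteq> q" for j
      using Q_iff[of j] 3 that by auto
    \<comment> \<open>The variance contributed by the scaled loading of \<open>p\<close> grows by exactly \<open>l $ p / 2\<close>.\<close>
    define c where "c = sqrt (1 + l $ p / (2 * (A $$ (p, g))\<^sup>2))"
    have "0 < l $ p / (2 * (A $$ (p, g))\<^sup>2)" using l[OF p(1)] p(3) by simp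
    then have c2: "c\<^sup>2 = 1 + l $ p / (2 * (A $$ (p, g))\<^sup>2)" and c: "1 < c"
      by (simp_all add: c_def)
    have cp: "(c * A $$ (p, g))\<^sup>2 = (A $$ (p, g))\<^sup>2 + l $ p / 2"
      unfolding power_mult_distrib c2 using p(3) by (simp add: distrib_right)
    have cq: "(A $$ (q, g) / c)\<^sup>2 \<le> (A $$ (q, g))\<^sup>2"
    proof -
      have "(A $$ (q, g))\<^sup>2 / c\<^sup>2 \<le> (A $$ (q, g))\<^sup>2 / 1"
        using c by (intro divide_left_mono) (auto simp: one_le_power)
      then show ?thesis by (simp add: power_divide)
    qed
    let ?b = "\<lambda>j. if j = p then c * A $$ (p, g) else if j = q then A $$ (q, g) / c else A $$ (j, t j)"
    show ?thesis
    proof (rule not_identifiableI[OF t \<theta>, where a = "\<lambda>j. A $$ (j, 0)" and b = ?b and ?j0.0 = p])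
      show "A $$ (i, 0) * A $$ (j, 0) + (if t i = t j then ?b i * ?b j else 0)
        = A $$ (i, 0) * A $$ (j, 0) + (if t i = t j then A $$ (i, t i) * A $$ (j, t j) else 0)"
        if "i < J" "j < J" "i \<noteq> j" for i j
      proof -
        have "?b i * ?b j = A $$ (i, t i) * A $$ (j, t j)" if "t i = t j"
        proof (cases "{i, j} = {p, q}")
          case True
          with c p q 3(2) \<open>i \<noteq> j\<close> show ?thesis by (auto simp: doubleton_eq_iff)
        next
          case False
          then have "t i = g \<Longrightarrow> i \<notin> {p, q} \<or> j \<notin> {p, q}"
            using \<open>i \<noteq> j\<close> by auto
          then show ?thesis
            using others[of i] others[of j] \<open>i < J\<close> \<open>j < J\<close> that p q by auto
        qed
        then show ?thesis by simp
      qed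
      show "(A $$ (j, 0))\<^sup>2 + (?b j)\<^sup>2 < (A $$ (j, 0))\<^sup>2 + (A $$ (j, t j))\<^sup>2 + l $ j" if "j < J" for j
        using l[OF that] cp cq p q by auto
      have "\<bar>c * A $$ (p, g)\<bar> \<noteq> \<bar>A $$ (p, g)\<bar>"
        using c p(3) by (simp add: abs_mult)
      then show "\<bar>A $$ (p, 0)\<bar> \<noteq> \<bar>A $$ (p, 0)\<bar> \<or> \<bar>?b p\<bar> \<noteq> \<bar>A $$ (p, t p)\<bar>"
        using p by simp
    qed (fact p)
  qed
qed

lemma no_main_loading_not_identifiable:
  assumes t: "t ` {..<J} = {1..G}" and \<theta>: "(A, d, l) \<in> bifactor_param_space J G t" and G: "1 \<le> G"
    and zero: "\<And>j. j < J \<Longrightarrow> A $$ (j, 0) = 0"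
  shows "\<not> bifactor_identifiable_at J G t (A, d, l)"
proof -
  have l: "0 < l $ j" if "j < J" for j using param_space_variance_pos[OF \<theta> that] .
  have "1 \<in> t ` {..<J}" using t G by simp
  then obtain j0 where j0: "j0 < J" by auto
  have nz: "l $ j0 \<noteq> 0" using l[OF j0] by simp
  show ?thesis
    by (rule not_identifiableI[OF t \<theta>, where a = "\<lambda>j. if j = j0 then sqrt (l $ j0 / 2) else 0"
          and b = "\<lambda>j. A $$ (j, t j)" and ?j0.0 = j0])
      (use l nz zero j0 in \<open>simp_all add: less_imp_le\<close>)
qed

text \<open>
  Inside the only testlet with main loadings the pair of columns may be rotated, since the other
  main loadings vanish and no covariance across testlets is affected. The rotation chosen here makes
  the main loading of \<open>j0\<close> zero.
\<close>

lemma one_main_testlet_not_identifiable: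
  assumes t: "t ` {..<J} = {1..G}" and \<theta>: "(A, d, l) \<in> bifactor_param_space J G t"
    and j0: "j0 < J" "A $$ (j0, 0) \<noteq> 0" and zero: "\<And>j. j < J \<Longrightarrow> t j \<noteq> t j0 \<Longrightarrow> A $$ (j, 0) = 0"
  shows "\<not> bifactor_identifiable_at J G t (A, d, l)"
proof -
  have l: "0 < l $ j" if "j < J" for j using param_space_variance_pos[OF \<theta> that] .
  \<comment> \<open>The rotation takes the row \<open>(u, v)\<close> of \<open>j0\<close> to \<open>(0, sqrt r)\<close>.\<close>
  define u v where "u = A $$ (j0, 0)" and "v = A $$ (j0, t j0)"
  define r where "r = u\<^sup>2 + v\<^sup>2"
  have r: "0 < r" using j0(2) by (simp add: r_def u_def sum_power2_gt_zero_iff)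
  let ?a = "\<lambda>j. if t j = t j0 then (v * A $$ (j, 0) - u * A $$ (j, t j)) / sqrt r else A $$ (j, 0)"
  let ?b = "\<lambda>j. if t j = t j0 then (u * A $$ (j, 0) + v * A $$ (j, t j)) / sqrt r else A $$ (j, t j)"
  have rot: "(v * x - u * y) / sqrt r * ((v * x' - u * y') / sqrt r) + (u * x + v * y) / sqrt r * ((u * x' + v * y') / sqrt r)
      = x * x' + y * y'" for x y x' y'
  proof -
    have "(v * x - u * y) * (v * x' - u * y') + (u * x + v * y) * (u * x' + v * y') = (x * x' + y * y') * r"
      by (simp add: r_def power2_eq_square algebra_simps)
    then have "((v * x - u * y) * (v * x' - u * y') + (u * x + v * y) * (u * x' + v * y')) / r = x * x' + y * y'"
      using r by simp
    moreover have "p / sqrt r * (q / sqrt r) = p * q / r" for p q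
      using r by simp
    ultimately show ?thesis
      by (simp only: add_divide_distrib[symmetric])
  qed
  show ?thesis
  proof (rule not_identifiableI[OF t \<theta>, where a = ?a and b = ?b and ?j0.0 = j0])
    show "?a i * ?a j + (if t i = t j then ?b i * ?b j else 0)
        = A $$ (i, 0) * A $$ (j, 0) + (if t i = t j then A $$ (i, t i) * A $$ (j, t j) else 0)"
      if "i < J" "j < J" "i \<noteq> j" for i j
      using rot zero[of i] zero[of j] that by (cases "t i = t j0"; cases "t j = t j0") simp_all
    show "(?a j)\<^sup>2 + (?b j)\<^sup>2 < (A $$ (j, 0))\<^sup>2 + (A $$ (j, t j))\<^sup>2 + l $ j" if "j < J" for j
    proof -
      have "(?a j)\<^sup>2 + (?b j)\<^sup>2 = (A $$ (j, 0))\<^sup>2 + (A $$ (j, t j))\<^sup>2"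
        unfolding power2_eq_square using rot by simp
      with l[OF that] show ?thesis by simp
    qed
    have "\<bar>?a j0\<bar> = 0" by (simp add: u_def v_def)
    moreover have "\<bar>A $$ (j0, 0)\<bar> \<noteq> 0" using j0(2) by simp
    ultimately show "\<bar>?a j0\<bar> \<noteq> \<bar>A $$ (j0, 0)\<bar> \<or> \<bar>?b j0\<bar> \<noteq> \<bar>A $$ (j0, t j0)\<bar>" by metis
  qed (fact j0)
qed

text \<open>
  Multiplying the main loadings by \<open>c\<close> on one testlet and by \<open>1 / c\<close> on the other preserves the
  covariances across testlets. Both testlets can absorb this in their testlet loadings when \<open>c\<close> is
  close to 1, and some such \<open>c\<close> differs from 1.
\<close>

lemma two_main_testlets_not_identifiable:
  assumes t: "t ` {..<J} = {1..G}" and \<theta>: "(A, d, l) \<in> bifactor_param_space J G t"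
    and Q: "\<And>g. g \<in> {1..G} \<Longrightarrow> 3 \<le> card (testlet_support J A g)"
    and H1: "main_loaded_testlets J G t A = {g, h}" "g \<noteq> h"
    and H2: "split_rank_testlets J G t A = {}"
  shows "\<not> bifactor_identifiable_at J G t (A, d, l)"
proof -
  have A: "A \<in> carrier_mat J (1 + G)" using \<theta> by (simp add: bifactor_param_space_def)
  have l: "0 < l $ j" if "j < J" for j using param_space_variance_pos[OF \<theta> that] .
  have tj: "t j \<in> {1..G}" if "j < J" for j using t that by blast
  have gh: "g \<in> {1..G}" "h \<in> {1..G}" using H1(1) by (auto simp: main_loaded_testlets_def)
  have zero: "A $$ (j, 0) = 0" if "j < J" "t j \<noteq> g" "t j \<noteq> h" for j
  proof -
    have "t j \<notin> main_loaded_testlets J G t A" using H1 that by simp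
    then show ?thesis using tj[OF that(1)] that(1) by (auto simp: main_loaded_testlets_def testlet_items_def)
  qed
  \<comment> \<open>Testlet \<open>k\<close> absorbs the factor \<open>c\<close> on its main loadings by the new testlet loadings \<open>b'\<close>.\<close>
  define P where "P k c b' \<longleftrightarrow> (\<forall>i\<in>testlet_items J t k. \<forall>j\<in>testlet_items J t k. i \<noteq> j \<longrightarrow>
        c\<^sup>2 * (A $$ (i, 0) * A $$ (j, 0)) + b' i * b' j = A $$ (i, 0) * A $$ (j, 0) + A $$ (i, k) * A $$ (j, k)) \<and>
      (\<forall>j\<in>testlet_items J t k. c\<^sup>2 * (A $$ (j, 0))\<^sup>2 + (b' j)\<^sup>2 < (A $$ (j, 0))\<^sup>2 + (A $$ (j, k))\<^sup>2 + l $ j)"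
    for k c and b' :: "nat \<Rightarrow> real"
  have adj: "\<forall>\<^sub>F c in nhds 1. \<exists>b'. P k c b'" if k: "k \<in> {1..G}" for k
    unfolding P_def
  proof (rule adjustable_if_no_disjoint_independent_pairs)
    show "finite (testlet_items J t k)" by (simp add: testlet_items_def)
    show "0 < l $ j" if "j \<in> testlet_items J t k" for j
      using that l by (simp add: testlet_items_def)
    show "A $$ (i, 0) * A $$ (j, k) = A $$ (j, 0) * A $$ (i, k) \<or> A $$ (p, 0) * A $$ (q, k) = A $$ (q, 0) * A $$ (p, k)"
      if "i \<in> testlet_items J t k" "j \<in> testlet_items J t k" "p \<in> testlet_items J t k" "q \<in> testlet_items J t k"
        "{i, j} \<inter> {p, q} = {}" for i j p q
    proof (rule ccontr)
      assume "\<not> ?thesis"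
      with that k have "k \<in> split_rank_testlets J G t A"
        unfolding split_rank_testlets_iff[OF A]
        by - (rule conjI, assumption, rule bexI[of _ i], rule bexI[of _ j], rule bexI[of _ p], rule bexI[of _ q], simp_all)
      with H2 show False by simp
    qed
    have "testlet_support J A k = {j \<in> testlet_items J t k. A $$ (j, k) \<noteq> 0}"
      using param_space_zero[OF \<theta> _ k] by (auto simp: testlet_support_def testlet_items_def)
    with Q[OF k] show "3 \<le> card {j \<in> testlet_items J t k. A $$ (j, k) \<noteq> 0}" by simp
  qed
  have inv: "filterlim (\<lambda>c::real. 1 / c) (nhds 1) (nhds 1)"
    by (auto intro!: tendsto_eq_intros filterlim_ident)
  have pos: "\<forall>\<^sub>F c::real in nhds 1. 0 < c"
    using order_tendstoD(1)[OF filterlim_ident[of "nhds (1::real)"], of 0] by simp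
  have "\<forall>\<^sub>F c in nhds 1. 0 < c \<and> (\<exists>b'. P g c b') \<and> (\<exists>b'. P h (1 / c) b')"
    using pos adj[OF gh(1)] eventually_compose_filterlim[OF adj[OF gh(2)] inv] by eventually_elim simp
  \<comment> \<open>Passing to the punctured neighbourhood makes the competing main loadings genuinely different.\<close>
  then have "\<forall>\<^sub>F c in at 1. c \<noteq> 1 \<and> 0 < c \<and> (\<exists>b'. P g c b') \<and> (\<exists>b'. P h (1 / c) b')"
    unfolding eventually_at_filter by eventually_elim simp
  from eventually_happens'[OF at_neq_bot this]
  obtain c b1 b2 where c: "c \<noteq> 1" "0 < c" and P: "P g c b1" "P h (1 / c) b2"
    by (elim exE conjE)
  note b1 = P(1)[unfolded P_def, THEN conjunct1, rule_format] P(1)[unfolded P_def, THEN conjunct2, rule_format]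
  note b2 = P(2)[unfolded P_def, THEN conjunct1, rule_format] P(2)[unfolded P_def, THEN conjunct2, rule_format]
  let ?s = "\<lambda>j. if t j = g then c else if t j = h then 1 / c else 1"
  let ?a = "\<lambda>j. ?s j * A $$ (j, 0)"
  let ?b = "\<lambda>j. if t j = g then b1 j else if t j = h then b2 j else A $$ (j, t j)"
  obtain j0 where j0: "j0 < J" "t j0 = g" "A $$ (j0, 0) \<noteq> 0"
  proof -
    have "g \<in> main_loaded_testlets J G t A" using H1 by simp
    then show thesis using that by (auto simp: main_loaded_testlets_def testlet_items_def)
  qed
  have ss: "?s i * A $$ (i, 0) * (?s j * A $$ (j, 0)) = A $$ (i, 0) * A $$ (j, 0)"
    if "i < J" "j < J" "t i \<noteq> t j" for i j
    using zero[OF that(1)] zero[OF that(2)] that c H1(2) by auto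
  show ?thesis
  proof (rule not_identifiableI[OF t \<theta>, where a = ?a and b = ?b and ?j0.0 = j0])
    show "?a i * ?a j + (if t i = t j then ?b i * ?b j else 0)
        = A $$ (i, 0) * A $$ (j, 0) + (if t i = t j then A $$ (i, t i) * A $$ (j, t j) else 0)"
      if "i < J" "j < J" "i \<noteq> j" for i j
    proof (cases "t i = t j")
      case True
      consider "t j = g" | "t j = h" | "t j \<noteq> g" "t j \<noteq> h" by blast
      then show ?thesis
      proof cases
        case 1
        then show ?thesis
          using b1(1)[of i j] that True by (simp add: testlet_items_def power2_eq_square mult_ac)
      next
        case 2
        then show ?thesis
          using b2(1)[of i j] that True H1(2) by (simp add: testlet_items_def power2_eq_square mult_ac)
      qed (use True in simp)
    qed (use ss[of i j] that in simp)
    show "(?a j)\<^sup>2 + (?b j)\<^sup>2 < (A $$ (j, 0))\<^sup>2 + (A $$ (j, t j))\<^sup>2 + l $ j" if "j < J" for j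
    proof -
      consider "t j = g" | "t j = h" | "t j \<noteq> g" "t j \<noteq> h" by blast
      then show ?thesis
      proof cases
        case 1
        then show ?thesis using b1(2)[of j] that by (simp add: testlet_items_def power_mult_distrib)
      next
        case 2
        then show ?thesis
          using b2(2)[of j] that H1(2) by (simp add: testlet_items_def power_mult_distrib power_divide)
      qed (use l[OF that] in simp)
    qed
    have "\<bar>?a j0\<bar> \<noteq> \<bar>A $$ (j0, 0)\<bar>"
      using j0 c by (simp add: abs_mult)
    then show "\<bar>?a j0\<bar> \<noteq> \<bar>A $$ (j0, 0)\<bar> \<or> \<bar>?b j0\<bar> \<noteq> \<bar>A $$ (j0, t j0)\<bar>" ..
  qed (fact j0)
qed

theorem bifactor_identifiable_only_if:
  assumes G: "1 \<le> G" and t: "t ` {..<J} = {1..G}" and \<theta>: "(A, d, l) \<in> bifactor_param_space J G t"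
    and ident: "bifactor_identifiable_at J G t (A, d, l)"
  shows "(\<forall>g\<in>{1..G}. 3 \<le> card (testlet_support J A g)) \<and>
    (3 \<le> card (main_loaded_testlets J G t A) \<or>
      card (main_loaded_testlets J G t A) = 2 \<and> split_rank_testlets J G t A \<noteq> {})"
proof -
  have Q: "3 \<le> card (testlet_support J A g)" if "g \<in> {1..G}" for g
    using sparse_testlet_not_identifiable[OF t \<theta> that] ident by fastforce
  have tj: "t j \<in> {1..G}" if "j < J" for j using t that by blast
  have loaded: "t j \<in> main_loaded_testlets J G t A \<longleftrightarrow> (\<exists>i<J. t i = t j \<and> A $$ (i, 0) \<noteq> 0)" if "j < J" for j
    using tj[OF that] by (auto simp: main_loaded_testlets_def testlet_items_def)
  have fin: "finite (main_loaded_testlets J G t A)"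
    by (simp add: main_loaded_testlets_def)
  have "3 \<le> card (main_loaded_testlets J G t A) \<or>
      card (main_loaded_testlets J G t A) = 2 \<and> split_rank_testlets J G t A \<noteq> {}"
  proof (rule ccontr)
    assume small: "\<not> ?thesis"
    then have lt: "card (main_loaded_testlets J G t A) < 3" by simp
    show False
    proof (cases rule: card_less_3_cases[OF fin lt])
      case 1
      have "A $$ (j, 0) = 0" if "j < J" for j
        using loaded[OF that] that unfolding 1 by blast
      then have "\<not> bifactor_identifiable_at J G t (A, d, l)"
        by (rule no_main_loading_not_identifiable[OF t \<theta> G])
      with ident show False by simp
    next
      case (2 g)
      then have "g \<in> main_loaded_testlets J G t A" by simp
      then obtain j0 where j0: "j0 < J" "t j0 = g" "A $$ (j0, 0) \<noteq> 0"
        by (auto simp: main_loaded_testlets_def testlet_items_def)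
      have "A $$ (j, 0) = 0" if "j < J" "t j \<noteq> t j0" for j
        using loaded[OF that(1)] that unfolding 2 j0(2) by blast
      then have "\<not> bifactor_identifiable_at J G t (A, d, l)"
        by (rule one_main_testlet_not_identifiable[OF t \<theta> j0(1,3)])
      with ident show False by simp
    next
      case (3 g h)
      then have "split_rank_testlets J G t A = {}" using small by auto
      with two_main_testlets_not_identifiable[OF t \<theta> Q 3] ident show False by simp
    qed
  qed
  with Q show ?thesis by blast
qed

section \<open>The characterisation\<close>

theorem theorem1:
  fixes J G :: nat and t :: "nat \<Rightarrow> nat" and A :: "real mat" and d l :: "real vec"
  assumes "G \<ge> 1"
    and "t ` {..<J} = {1..G}"
    and "(A, d, l) \<in> bifactor_param_space J G t"
  shows "bifactor_identifiable_at J G t (A, d, l) \<longleftrightarrow>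
    ((\<forall>g\<in>{1..G}. card (testlet_support J A g) \<ge> 3) \<and>
      card (main_loaded_testlets J G t A) \<ge> 3) \<or>
    ((\<forall>g\<in>{1..G}. card (testlet_support J A g) \<ge> 3) \<and>
      card (main_loaded_testlets J G t A) = 2 \<and>
      card (split_rank_testlets J G t A) \<ge> 1)"
proof -
  have "finite (split_rank_testlets J G t A)"
    by (simp add: split_rank_testlets_def)
  then have "card (split_rank_testlets J G t A) \<ge> 1 \<longleftrightarrow> split_rank_testlets J G t A \<noteq> {}"
    by (simp add: Suc_le_eq card_gt_0_iff)
  then show ?thesis
    using bifactor_identifiable_only_if[OF assms] bifactor_identifiable_if[OF assms(2,3)] by blast
qed

end
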